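(* Let $\ell$ be an odd prime, let $m\ge 0$ be an integer, and put $k=\ell m+(\ell-3)$. Let $q=e^{2\pi i\tau}$, $\zeta=e^{2\pi i z}$, and define $$C_{k,3}(z,\tau)=\prod_{n=1}^\infty\frac{(1+q^n)(1+\zeta^{\ell-2}q^n)(1+\zeta^{-(\ell-2)}q^n)}{\big[(1-q^n)(1-\zeta^{\ell-2}q^n)(1-\zeta^{-(\ell-2)}q^n)\big]^m\Big[\prod_{a\in\{1,3,\dots,\ell-4\}}(1-\zeta^{a}q^n)(1-\zeta^{-a}q^n)\Big]^{m+1}}$$ (the last product being empty when $\ell=3$). Then $C_{k,3}$ is a crank generating function for $p_{k,3}(n)$, i.e. setting $\zeta=1$ gives $\sum_{n\ge0}p_{k,3}(n)q^n$, and it explains the congruences $p_{k,3}(\ell n+\delta)\equiv0\pmod{\ell}$ for every integer $\delta$ such that $4\delta+1$ is a quadratic non-residue modulo $\ell$: for every such $\delta$ and every integer $n\ge0$, the coefficient of $q^{\ell n+\delta}$ in $C_{k,3}(z,\tau)$ (a Laurent polynomial in $\zeta$ with integer coefficients) is divisible by the $\ell$-th cyclotomic polynomial $\Phi_\ell(\zeta)$ (equivalently, vanishes at $\zeta=e^{2\pi i/\ell}$); in particular $p_{k,3}(\ell n+\delta)\equiv0\pmod{\ell}$.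
   Context: For nonnegative integers $k,j$, $p_{k,j}(n)$ denotes the number of $(k+j)$-colored partitions of $n$ in which $j$ of the colors have distinct parts, i.e. $\sum_{n\ge0}p_{k,j}(n)q^n=\prod_{n\ge1}\frac{(1+q^n)^j}{(1-q^n)^k}$. An integer $a$ is a quadratic non-residue modulo $\ell$ if $a$ is not congruent to any square $x^2$ (including $0$) modulo $\ell$. *)

theory Defs
  imports
    "HOL-Analysis.Analysis"
    "HOL-Library.Multiset"
    "HOL-Library.Poly_Mapping"
    "HOL-Computational_Algebra.Computational_Algebra"
    "HOL-Number_Theory.Residues"
begin

text \<open>A part is a pair \<open>(i, c)\<close> of size \<open>i\<close> and colour \<open>c < k + j\<close>; the colours with distinct
  parts are \<open>k, \<dots>, k + j - 1\<close>.\<close>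

definition colored_partitions :: "nat \<Rightarrow> nat \<Rightarrow> nat \<Rightarrow> (nat \<times> nat) multiset set" where
  "colored_partitions k j n =
    {M. (\<forall>(i, c) \<in># M. 1 \<le> i \<and> c < k + j) \<and>
        (\<forall>i c. k \<le> c \<longrightarrow> count M (i, c) \<le> 1) \<and>
        sum_mset (image_mset fst M) = n}"

definition num_colored_partitions :: "nat \<Rightarrow> nat \<Rightarrow> nat \<Rightarrow> nat" where
  "num_colored_partitions k j n = card (colored_partitions k j n)"

text \<open>Laurent polynomials in \<open>\<zeta>\<close> over the integers form the group ring of the integers:
  finitely supported functions from exponents to coefficients, under convolution.\<close>

type_synonym laurent = "(int, int) poly_mapping"

definition zeta_pow :: "int \<Rightarrow> laurent" where
  "zeta_pow a = Poly_Mapping.single a 1"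

definition laurent_eval :: "laurent \<Rightarrow> complex \<Rightarrow> complex" where
  "laurent_eval c x =
    (\<Sum>a \<in> Poly_Mapping.keys c. of_int (Poly_Mapping.lookup c a) * x powi a)"

definition laurent_of_poly :: "int poly \<Rightarrow> laurent" where
  "laurent_of_poly f = (\<Sum>i\<le>Polynomial.degree f. Poly_Mapping.single (int i) (Polynomial.coeff f i))"

definition cyclotomic_poly :: "nat \<Rightarrow> int poly" where
  "cyclotomic_poly n =
    (THE f. map_poly of_int f =
      (\<Prod>j | j \<in> {1..n} \<and> coprime j n. [:- cis (2 * pi * real j / real n), 1:]))"

text \<open>Numerator and denominator of the \<open>n\<close>-th factor of the product. They are polymorphic, with
  \<open>Z a\<close> in the role of \<open>\<zeta>\<^sup>a\<close>, so that they serve for complex numbers and for formal series alike.\<close>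

definition crank_num :: "nat \<Rightarrow> (int \<Rightarrow> 'a) \<Rightarrow> 'a \<Rightarrow> nat \<Rightarrow> 'a :: comm_ring_1" where
  "crank_num l Z q n =
    (1 + q ^ n) * (1 + Z (int l - 2) * q ^ n) * (1 + Z (- (int l - 2)) * q ^ n)"

definition crank_den :: "nat \<Rightarrow> nat \<Rightarrow> (int \<Rightarrow> 'a) \<Rightarrow> 'a \<Rightarrow> nat \<Rightarrow> 'a :: comm_ring_1" where
  "crank_den l m Z q n =
    ((1 - q ^ n) * (1 - Z (int l - 2) * q ^ n) * (1 - Z (- (int l - 2)) * q ^ n)) ^ m *
    (\<Prod>a | odd a \<and> 1 \<le> a \<and> a \<le> int l - 4.
       (1 - Z a * q ^ n) * (1 - Z (- a) * q ^ n)) ^ (m + 1)"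

definition crank :: "nat \<Rightarrow> nat \<Rightarrow> complex \<Rightarrow> complex \<Rightarrow> complex" where
  "crank l m z \<tau> =
    (let q = exp (2 * pi * \<i> * \<tau>); Z = (\<lambda>a. exp (2 * pi * \<i> * z) powi a)
     in prodinf (\<lambda>n. crank_num l Z q (Suc n) / crank_den l m Z q (Suc n)))"

text \<open>The same product as a formal power series in \<open>q\<close> over the Laurent polynomials in \<open>\<zeta>\<close>,
  convergent in the \<open>q\<close>-adic topology. The coefficient ring is not a field, so the reciprocal of
  the denominator, which has constant term 1, is taken with \<open>fps_right_inverse\<close>.\<close>

definition crank_series :: "nat \<Rightarrow> nat \<Rightarrow> laurent fps" where
  "crank_series l m =
    (let q = fps_X; Z = (\<lambda>a. fps_const (zeta_pow a))
     in prodinf (\<lambda>n. crank_num l Z q (Suc n) * fps_right_inverse (crank_den l m Z q (Suc n)) 1))"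

end

theory Submission
  imports Defs "HOL-Complex_Analysis.Complex_Analysis"
begin

text \<open>At a nontrivial \<open>l\<close>-th root of unity \<open>\<zeta>\<close> the numbers \<open>\<plusminus>1, \<plusminus>3, \<dots>, \<plusminus>(l - 2)\<close> together with \<open>0\<close> represent all
  residues, so multiplying numerator and denominator of the \<open>n\<close>-th factor by
  \<open>(1 - q\<^sup>n) (1 - \<zeta>\<^bsup>l-2\<^esup> q\<^sup>n) (1 - \<zeta>\<^bsup>2-l\<^esup> q\<^sup>n)\<close> turns the denominator into a power of \<open>1 - q\<^bsup>ln\<^esup>\<close> and the
  numerator into the triple product
  \<open>(1 - q\<^bsup>2n\<^esup>) (1 - w q\<^bsup>2n\<^esup>) (1 - w\<^bsup>-1\<^esup> q\<^bsup>2n\<^esup>)\<close> with \<open>w = \<zeta>\<^bsup>2(l-2)\<^esup> \<noteq> 1\<close>. By Jacobi's identity only the exponents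
  \<open>t (t + 1)\<close> occur in the numerator, and \<open>4 t (t + 1) + 1\<close> is a square. So the coefficients in question vanish at
  all primitive \<open>l\<close>-th roots of unity; as the cyclotomic polynomial is monic with these simple roots, division
  with remainder over the integers gives divisibility.\<close>

section \<open>Truncated congruence of formal power series\<close>

text \<open>A coefficient of \<open>q ^ N\<close> involves finitely many factors only, so product
  identities are used as congruences modulo a power of \<open>q\<close>. This allows Jacobi's
  identity to enter in its finite form, a consequence of the q-binomial theorem, and no two-sided
  infinite sum needs a meaning. The Laurent polynomials are not a field; evaluation at a nonzero
  complex number is a ring homomorphism and moves the reciprocals to complex power series, where
  they are ordinary inverses. The way back from the numerator to the quotient rests on the exponents
  of a power of \<open>1 - q ^ (l * n)\<close> being multiples of \<open>l\<close>: multiplication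
  by it mixes coefficients within one residue class modulo \<open>l\<close> only, so vanishing on a
  class survives division. The shape of \<open>k\<close> reflects this: the denominator has the
  exponents 0 and \<plusminus>(l - 2) only \<open>m\<close> times and all others
  \<open>m + 1\<close> times, so one more copy of these three completes \<open>m + 1\<close> full
  residue systems.\<close>

definition fps_cong :: "nat \<Rightarrow> 'a::comm_ring_1 fps \<Rightarrow> 'a fps \<Rightarrow> bool" where
  "fps_cong n f g \<longleftrightarrow> (\<forall>i<n. fps_nth f i = fps_nth g i)"

lemma fps_cong_refl [simp]: "fps_cong n f f"
  by (simp add: fps_cong_def)

lemma fps_cong_sym: "fps_cong n f g \<Longrightarrow> fps_cong n g f"
  by (simp add: fps_cong_def)

lemma fps_cong_trans [trans]: "fps_cong n f g \<Longrightarrow> fps_cong n g h \<Longrightarrow> fps_cong n f h"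
  by (simp add: fps_cong_def)

lemma fps_cong_mono: "fps_cong n f g \<Longrightarrow> m \<le> n \<Longrightarrow> fps_cong m f g"
  by (simp add: fps_cong_def)

lemma fps_cong_mult:
  assumes "fps_cong n f f'" "fps_cong n g g'"
  shows "fps_cong n (f * g) (f' * g')"
  using assms by (auto simp: fps_cong_def fps_mult_nth intro!: sum.cong)

lemma fps_cong_mult_one:
  "fps_cong n f 1 \<Longrightarrow> fps_cong n g 1 \<Longrightarrow> fps_cong n (f * g) 1"
  using fps_cong_mult[of n f 1 g 1] by simp

lemma fps_cong_power_one: "fps_cong n f 1 \<Longrightarrow> fps_cong n (f ^ k) 1"
  by (induction k) (auto intro: fps_cong_mult_one)

lemma fps_cong_prod_one:
  "(\<And>x. x \<in> A \<Longrightarrow> fps_cong n (f x) 1) \<Longrightarrow> fps_cong n (\<Prod>x\<in>A. f x) 1"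
  by (induction A rule: infinite_finite_induct) (auto intro: fps_cong_mult_one)

lemma fps_cong_one_plus: "fps_cong n (1 + f * fps_X ^ n) 1"
  by (simp add: fps_cong_def fps_X_power_mult_right_nth)

lemma fps_cong_one_minus: "fps_cong n (1 - f * fps_X ^ n) 1"
  by (simp add: fps_cong_def fps_X_power_mult_right_nth)

text \<open>Multiply \<open>f\<close> \<equiv> 1 by \<open>g\<close>. Only a one-sided factor is
  asked for, so that \<open>fps_right_inverse\<close> over the Laurent polynomials is covered as
  well as \<open>inverse\<close> over a field.\<close>

lemma fps_cong_right_factor_one:
  assumes "f * g = 1" "fps_cong n f 1"
  shows "fps_cong n g 1"
  using fps_cong_mult[OF fps_cong_sym[OF assms(2)], of g g] assms(1) by simp

lemma fps_cong_prod_subset: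
  assumes "finite A" "B \<subseteq> A" "\<And>x. x \<in> A - B \<Longrightarrow> fps_cong n (f x) 1"
  shows "fps_cong n (\<Prod>x\<in>A. f x) (\<Prod>x\<in>B. f x)"
  using fps_cong_mult[OF fps_cong_prod_one[of "A - B" n f, OF assms(3)], of "prod f B" "prod f B"] assms(1,2)
  by (simp add: prod.subset_diff[of B A f])

lemma fps_cong_prod_atMost:
  assumes "\<And>n. fps_cong (Suc n) (f n) 1" and "N \<le> M"
  shows "fps_cong (Suc N) (\<Prod>n\<le>M. f n) (\<Prod>n\<le>N. f n)"
  using assms(2) by (intro fps_cong_prod_subset) (auto intro!: fps_cong_mono[OF assms(1)])

lemma fps_prod_tendsto:
  assumes "\<And>n. fps_cong (Suc n) (f n) 1"
  shows "(\<lambda>M. \<Prod>n\<le>M. f n) \<longlonglongrightarrow> Abs_fps (\<lambda>N. fps_nth (\<Prod>n\<le>N. f n) N)"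
proof (rule tendsto_fpsI)
  fix N
  show "eventually (\<lambda>M. fps_nth (\<Prod>n\<le>M. f n) N = fps_nth (Abs_fps (\<lambda>N. fps_nth (\<Prod>n\<le>N. f n) N)) N) sequentially"
    using eventually_ge_at_top[of N]
  proof eventually_elim
    case (elim M)
    show ?case
      using fps_cong_prod_atMost[OF assms elim] by (simp add: fps_cong_def)
  qed
qed

lemma prodinf_fps:
  fixes f :: "nat \<Rightarrow> 'a::idom fps"
  assumes "\<And>n. fps_cong (Suc n) (f n) 1"
  shows "prodinf f = Abs_fps (\<lambda>N. fps_nth (\<Prod>n\<le>N. f n) N)"
proof -
  \<comment> \<open>A raw product must have a nonzero limit; the constant coefficient 1 provides
    this.\<close>
  have "fps_nth (f 0) 0 = 1"
    using assms[of 0] by (simp add: fps_cong_def)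
  then have "fps_nth (Abs_fps (\<lambda>N. fps_nth (\<Prod>n\<le>N. f n) N)) 0 \<noteq> 0"
    by simp
  then have "Abs_fps (\<lambda>N. fps_nth (\<Prod>n\<le>N. f n) N) \<noteq> 0"
    by (metis fps_zero_nth)
  then have "f has_prod Abs_fps (\<lambda>N. fps_nth (\<Prod>n\<le>N. f n) N)"
    using fps_prod_tendsto[of f, OF assms] by (simp add: has_prod_def raw_has_prod_def)
  then show ?thesis
    by (rule has_prod_unique [symmetric])
qed

section \<open>Evaluation of Laurent polynomials\<close>

lemma laurent_eval_superset:
  assumes "finite S" "Poly_Mapping.keys c \<subseteq> S"
  shows "laurent_eval c x = (\<Sum>a\<in>S. of_int (Poly_Mapping.lookup c a) * x powi a)"
  unfolding laurent_eval_def
  by (rule sum.mono_neutral_left) (use assms in \<open>auto simp: in_keys_iff\<close>)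

lemma laurent_eval_add: "laurent_eval (c + d) x = laurent_eval c x + laurent_eval d x"
proof -
  let ?S = "Poly_Mapping.keys c \<union> Poly_Mapping.keys d"
  have "laurent_eval (c + d) x = (\<Sum>a\<in>?S. of_int (Poly_Mapping.lookup (c + d) a) * x powi a)"
    by (rule laurent_eval_superset) (auto simp: Poly_Mapping.keys_add)
  also have "\<dots> = laurent_eval c x + laurent_eval d x"
    by (subst (1 2) laurent_eval_superset[of ?S])
       (auto simp: lookup_add ring_distribs sum.distrib)
  finally show ?thesis .
qed

lemma laurent_eval_0 [simp]: "laurent_eval 0 x = 0"
  by (simp add: laurent_eval_def)

lemma laurent_eval_single [simp]: "laurent_eval (Poly_Mapping.single a c) x = of_int c * x powi a"
  by (subst laurent_eval_superset[of "{a}"]) auto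

lemma laurent_eval_1 [simp]: "laurent_eval 1 x = 1"
  using laurent_eval_single[of 0 1 x] by simp

lemma laurent_eval_zeta_pow [simp]: "laurent_eval (zeta_pow a) x = x powi a"
  by (simp add: zeta_pow_def)

lemma laurent_eval_sum: "laurent_eval (\<Sum>i\<in>A. f i) x = (\<Sum>i\<in>A. laurent_eval (f i) x)"
  by (induction A rule: infinite_finite_induct) (auto simp: laurent_eval_add)

lemma laurent_sum_singles:
  "(c::laurent) = (\<Sum>a\<in>Poly_Mapping.keys c. Poly_Mapping.single a (Poly_Mapping.lookup c a))"
proof (rule poly_mapping_eqI)
  fix k
  show "Poly_Mapping.lookup c k = Poly_Mapping.lookup
     (\<Sum>a\<in>Poly_Mapping.keys c. Poly_Mapping.single a (Poly_Mapping.lookup c a)) k"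
    by (auto simp: lookup_sum lookup_single when_def in_keys_iff)
qed

text \<open>Both sides are bilinear, so monomials suffice; \<open>x\<close> \<noteq> 0 is what
  splits \<open>x powi (a + b)\<close>.\<close>

lemma laurent_eval_mult:
  assumes "x \<noteq> 0"
  shows "laurent_eval (c * d) x = laurent_eval c x * laurent_eval d x"
proof -
  have single: "laurent_eval (Poly_Mapping.single a r * Poly_Mapping.single b s) x =
      laurent_eval (Poly_Mapping.single a r) x * laurent_eval (Poly_Mapping.single b s) x" for a b r s
    using assms by (simp add: mult_single power_int_add)
  show ?thesis
    by (subst (1 2) laurent_sum_singles[of c], subst (1 2) laurent_sum_singles[of d])
       (simp only: sum_distrib_left sum_distrib_right laurent_eval_sum single)
qed

definition laurent_eval_fps :: "complex \<Rightarrow> laurent fps \<Rightarrow> complex fps" where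
  "laurent_eval_fps x f = Abs_fps (\<lambda>n. laurent_eval (fps_nth f n) x)"

lemma laurent_eval_fps_nth [simp]: "fps_nth (laurent_eval_fps x f) n = laurent_eval (fps_nth f n) x"
  by (simp add: laurent_eval_fps_def)

lemma laurent_eval_uminus: "laurent_eval (-c) x = - laurent_eval c x"
  using laurent_eval_add[of "-c" c x] by (simp add: eq_neg_iff_add_eq_0)

lemma laurent_eval_fps_simps [simp]:
  "laurent_eval_fps x 1 = 1"
  "laurent_eval_fps x fps_X = fps_X"
  "laurent_eval_fps x (fps_const c) = fps_const (laurent_eval c x)"
  "laurent_eval_fps x (f + g) = laurent_eval_fps x f + laurent_eval_fps x g"
  "laurent_eval_fps x (f - g) = laurent_eval_fps x f - laurent_eval_fps x g"
  using laurent_eval_add[of _ "- _"]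
  by (auto simp: fps_eq_iff fps_X_def laurent_eval_add laurent_eval_uminus)

lemma laurent_eval_fps_mult [simp]:
  "x \<noteq> 0 \<Longrightarrow> laurent_eval_fps x (f * g) = laurent_eval_fps x f * laurent_eval_fps x g"
  by (auto simp: fps_eq_iff fps_mult_nth laurent_eval_sum laurent_eval_mult)

lemma laurent_eval_fps_power [simp]:
  "x \<noteq> 0 \<Longrightarrow> laurent_eval_fps x (f ^ k) = laurent_eval_fps x f ^ k"
  by (induction k) auto

lemma laurent_eval_fps_prod [simp]:
  "x \<noteq> 0 \<Longrightarrow> laurent_eval_fps x (\<Prod>i\<in>A. f i) = (\<Prod>i\<in>A. laurent_eval_fps x (f i))"
  by (induction A rule: infinite_finite_induct) auto

section \<open>The factors of the crank series\<close>

lemma fps_cong_crank_num: "fps_cong n (crank_num l Z fps_X n) 1"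
  using fps_cong_one_plus[of n 1]
  by (auto simp: crank_num_def intro!: fps_cong_mult_one fps_cong_one_plus)

lemma fps_cong_crank_den: "fps_cong n (crank_den l m Z fps_X n) 1"
  using fps_cong_one_minus[of n 1] unfolding crank_den_def
  by (intro fps_cong_mult_one fps_cong_power_one fps_cong_prod_one fps_cong_one_minus) auto

lemma crank_den_nth_0: "n > 0 \<Longrightarrow> fps_nth (crank_den l m Z fps_X n) 0 = 1"
  using fps_cong_crank_den[of n l m Z] by (simp add: fps_cong_def)

definition crank_factor :: "nat \<Rightarrow> nat \<Rightarrow> complex \<Rightarrow> nat \<Rightarrow> complex fps" where
  "crank_factor l m x n =
     crank_num l (\<lambda>a. fps_const (x powi a)) fps_X n * inverse (crank_den l m (\<lambda>a. fps_const (x powi a)) fps_X n)"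

text \<open>The bridge from the formal product to finite products over the complex numbers:
  evaluation respects products and sends a right inverse to the inverse, and factors beyond
  \<open>N\<close> leave coefficient \<open>N\<close> unchanged. The freedom in \<open>M\<close>
  serves the limit argument for the analytic product.\<close>

lemma laurent_eval_crank_series:
  assumes "x \<noteq> 0" "N \<le> M"
  shows "laurent_eval (fps_nth (crank_series l m) N) x =
         fps_nth (\<Prod>n\<le>M. crank_factor l m x (Suc n)) N"
proof -
  let ?Z = "\<lambda>a. fps_const (zeta_pow a)"
  let ?f = "\<lambda>n. crank_num l ?Z fps_X (Suc n) * fps_right_inverse (crank_den l m ?Z fps_X (Suc n)) 1"
  have den: "crank_den l m ?Z fps_X (Suc n) * fps_right_inverse (crank_den l m ?Z fps_X (Suc n)) 1 = 1" for n
    by (rule fps_right_inverse) (simp add: crank_den_nth_0)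
  have f1: "fps_cong (Suc n) (?f n) 1" for n
    by (intro fps_cong_mult_one fps_cong_crank_num fps_cong_right_factor_one[OF den fps_cong_crank_den])
  have eval_num: "laurent_eval_fps x (crank_num l ?Z fps_X n) = crank_num l (\<lambda>a. fps_const (x powi a)) fps_X n" for n
    using assms(1) by (simp add: crank_num_def)
  have eval_den: "laurent_eval_fps x (crank_den l m ?Z fps_X n) = crank_den l m (\<lambda>a. fps_const (x powi a)) fps_X n" for n
    using assms(1) by (simp add: crank_den_def)
  have eval_f: "laurent_eval_fps x (?f n) = crank_factor l m x (Suc n)" for n
  proof -
    have "laurent_eval_fps x (fps_right_inverse (crank_den l m ?Z fps_X (Suc n)) 1)
        = inverse (crank_den l m (\<lambda>a. fps_const (x powi a)) fps_X (Suc n))"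
      using arg_cong[OF den[of n], of "laurent_eval_fps x"] assms(1)
      by (intro fps_inverse_unique [symmetric]) (simp add: eval_den)
    then show ?thesis
      using assms(1) by (simp add: crank_factor_def eval_num)
  qed
  have "fps_nth (crank_series l m) N = fps_nth (\<Prod>n\<le>N. ?f n) N"
    unfolding crank_series_def Let_def by (subst prodinf_fps) (use f1 in auto)
  also have "\<dots> = fps_nth (\<Prod>n\<le>M. ?f n) N"
    using fps_cong_prod_atMost[of ?f, OF f1 assms(2)] by (simp add: fps_cong_def)
  finally have "laurent_eval (fps_nth (crank_series l m) N) x = fps_nth (laurent_eval_fps x (\<Prod>n\<le>M. ?f n)) N"
    by simp
  also have "laurent_eval_fps x (\<Prod>n\<le>M. ?f n) = (\<Prod>n\<le>M. crank_factor l m x (Suc n))"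
    by (simp only: laurent_eval_fps_prod[OF assms(1)] eval_f)
  finally show ?thesis .
qed

section \<open>The Jacobi triple product\<close>

text \<open>Gaussian binomial coefficients, given by the q-Pascal rule so that they exist in any
  commutative ring without division.\<close>

fun qbinomial :: "'a::comm_ring_1 \<Rightarrow> nat \<Rightarrow> nat \<Rightarrow> 'a" where
  "qbinomial q n 0 = 1"
| "qbinomial q 0 (Suc k) = 0"
| "qbinomial q (Suc n) (Suc k) = qbinomial q n k + q ^ Suc k * qbinomial q n (Suc k)"

definition qpoch :: "'a::comm_ring_1 \<Rightarrow> nat \<Rightarrow> 'a" where
  "qpoch q n = (\<Prod>i=1..n. 1 - q ^ i)"

lemma qpoch_0 [simp]: "qpoch q 0 = 1"
  by (simp add: qpoch_def)

lemma qpoch_Suc: "qpoch q (Suc n) = qpoch q n * (1 - q ^ Suc n)"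
  by (simp add: qpoch_def)

lemma qbinomial_eq_0: "n < k \<Longrightarrow> qbinomial q n k = 0"
  by (induction q n k rule: qbinomial.induct) auto

lemma qbinomial_self [simp]: "qbinomial q n n = 1"
  by (induction n) (auto simp: qbinomial_eq_0)

text \<open>The quotient formula for Gaussian binomials, cleared of denominators. The induction is
  on \<open>a + b\<close> because the Pascal rule lowers either \<open>a\<close> or
  \<open>b\<close>.\<close>

lemma qbinomial_mult_qpoch:
  "qbinomial q (a + b) a * qpoch q a * qpoch q b = qpoch q (a + b)"
proof (induction "a + b" arbitrary: a b)
  case (Suc n)
  consider "a = 0" | "b = 0" | a' b' where "a = Suc a'" "b = Suc b'"
    by (metis not0_implies_Suc)
  then show ?case
  proof cases
    case 3
    have n: "n = a' + b" "n = a + b'"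
      using Suc.hyps(2) 3 by auto
    have "qbinomial q (a + b) a * qpoch q a * qpoch q b =
        (1 - q ^ a) * (qbinomial q n a' * qpoch q a' * qpoch q b)
        + q ^ a * (1 - q ^ b) * (qbinomial q n a * qpoch q a * qpoch q b')"
      using Suc.hyps(2)[symmetric] 3 by (simp add: qpoch_Suc algebra_simps)
    also have "\<dots> = (1 - q ^ a) * qpoch q n + q ^ a * (1 - q ^ b) * qpoch q n"
      using Suc.hyps(1)[OF n(1)] Suc.hyps(1)[OF n(2)] n by simp
    \<comment> \<open>The two weights telescope: (1 - \<open>q ^ a\<close>) + \<open>q ^ a\<close>
      (1 - \<open>q ^ b\<close>) = 1 - \<open>q ^ (a + b)\<close>.\<close>
    also have "\<dots> = qpoch q n * (1 - q ^ Suc n)"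
      using n 3 by (simp add: algebra_simps power_add)
    finally show ?thesis
      using Suc.hyps(2) by (metis qpoch_Suc)
  qed auto
qed auto

text \<open>With base \<open>q\<^sup>2\<close> the usual exponent k (k - 1) / 2 becomes an integer
  expression without division. The induction splits off the factor \<open>i = 0\<close>, and the
  rest is the same product with \<open>b\<close> replaced by \<open>b * q\<^sup>2\<close>.\<close>

lemma qbinomial_theorem:
  fixes a b q :: "'a::comm_ring_1"
  shows "(\<Prod>i<n. a + b * (q\<^sup>2) ^ i) = (\<Sum>k\<le>n. qbinomial (q\<^sup>2) n k * q ^ (k * (k - 1)) * b ^ k * a ^ (n - k))"
proof (induction n arbitrary: b)
  case (Suc n)
  let ?c = "\<lambda>n k. qbinomial (q\<^sup>2) n k"
  let ?t = "\<lambda>k. ?c n k * q ^ (k * (k - 1)) * (q\<^sup>2) ^ k * b ^ k * a ^ (n - k)"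
  have "(\<Prod>i<Suc n. a + b * (q\<^sup>2) ^ i) = (a + b) * (\<Prod>i<n. a + (b * q\<^sup>2) * (q\<^sup>2) ^ i)"
    by (subst prod.lessThan_Suc_shift) (simp add: mult.assoc)
  also have "\<dots> = (a + b) * (\<Sum>k\<le>n. ?t k)"
    by (subst Suc.IH) (simp add: power_mult_distrib mult_ac)
  also have "\<dots> = (\<Sum>k\<le>n. a * ?t k) + (\<Sum>k\<le>n. b * ?t k)"
    by (simp add: ring_distribs sum_distrib_left sum.distrib)
  also have "(\<Sum>k\<le>n. a * ?t k) = (\<Sum>k\<le>Suc n. ?c n k * q ^ (k * (k - 1)) * (q\<^sup>2) ^ k * b ^ k * a ^ (Suc n - k))"
    by (simp add: qbinomial_eq_0 Suc_diff_le mult_ac)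
  also have "\<dots> = a ^ Suc n + (\<Sum>k\<le>n. ?c n (Suc k) * q ^ (Suc k * k) * (q\<^sup>2) ^ Suc k * b ^ Suc k * a ^ (n - k))"
    by (subst sum.atMost_Suc_shift) simp
  also have "(\<Sum>k\<le>n. b * ?t k) = (\<Sum>k\<le>n. ?c n k * q ^ (Suc k * k) * b ^ Suc k * a ^ (n - k))"
  proof (rule sum.cong)
    fix k
    have "Suc k * k = k * (k - 1) + 2 * k"
      by (cases k) auto
    then have "q ^ (Suc k * k) = q ^ (k * (k - 1)) * (q\<^sup>2) ^ k"
      by (simp only: power_add power_mult)
    then show "b * ?t k = ?c n k * q ^ (Suc k * k) * b ^ Suc k * a ^ (n - k)"
      by (simp add: mult_ac)
  qed simp
  finally have "(\<Prod>i<Suc n. a + b * (q\<^sup>2) ^ i) = a ^ Suc n +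
      (\<Sum>k\<le>n. ?c n (Suc k) * q ^ (Suc k * k) * (q\<^sup>2) ^ Suc k * b ^ Suc k * a ^ (n - k)
           + ?c n k * q ^ (Suc k * k) * b ^ Suc k * a ^ (n - k))"
    by (simp add: sum.distrib add.assoc)
  also have "\<dots> = a ^ Suc n + (\<Sum>k\<le>n. ?c (Suc n) (Suc k) * q ^ (Suc k * k) * b ^ Suc k * a ^ (n - k))"
    by (simp add: algebra_simps)
  also have "\<dots> = (\<Sum>k\<le>Suc n. ?c (Suc n) k * q ^ (k * (k - 1)) * b ^ k * a ^ (Suc n - k))"
    by (subst sum.atMost_Suc_shift) simp
  finally show ?case .
qed auto

text \<open>Substituting \<open>a = q\<^sup>2\<^sup>M\<close> and \<open>b = z q\<^sup>2\<close> in the \<open>q\<close>-binomial theorem with \<open>2 M\<close> factors and dividing by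
  \<open>q\<close> to the power \<open>3 M\<^sup>2 + M\<close> gives \<open>z\<^sup>M\<close> times the truncated triple product; \<open>k = M + j\<close> carries \<open>z\<^sup>j\<close>.\<close>

definition shifted_exponent :: "nat \<Rightarrow> nat \<Rightarrow> nat" where
  "shifted_exponent M k = nat ((int k - int M) * (int k - int M + 1))"

text \<open>A product of two consecutive integers is never negative, so \<open>nat\<close> loses
  nothing.\<close>

lemma int_shifted_exponent: "int (shifted_exponent M k) = (int k - int M) * (int k - int M + 1)"
proof -
  have "0 \<le> j * (j + 1)" for j :: int
    by (cases "j \<ge> 0") (auto intro: mult_nonpos_nonpos)
  then show ?thesis
    by (simp add: shifted_exponent_def)
qed

lemma finite_triple_product:
  fixes z z' q :: "'a::idom"
  assumes "z * z' = 1" "q \<noteq> 0"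
  shows "z ^ M * ((\<Prod>i<M. 1 + z * q ^ (2 * (i + 1))) * (\<Prod>i<M. 1 + z' * q ^ (2 * i))) =
    (\<Sum>k\<le>2*M. qbinomial (q\<^sup>2) (2 * M) k * z ^ k * q ^ shifted_exponent M k)"
proof -
  let ?f = "\<lambda>i. q ^ (2 * M) + (z * q\<^sup>2) * (q\<^sup>2) ^ i"
  \<comment> \<open>In the lower half the second summand is pulled out; since
    \<open>z * z' = 1\<close> this leaves the factors with \<open>z'\<close>, in reverse
    order.\<close>
  have "(\<Prod>i<M. ?f i) = (\<Prod>i<M. (z * q ^ (2 * (i + 1))) * (1 + z' * q ^ (2 * (M - 1 - i))))"
  proof (rule prod.cong)
    fix i assume i: "i \<in> {..<M}"
    have "q ^ (2 * M) = (z * z') * (q ^ (2 * (i + 1)) * q ^ (2 * (M - 1 - i)))"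
    proof -
      have "2 * M = 2 * (i + 1) + 2 * (M - 1 - i)"
        using i by auto
      then show ?thesis
        by (metis assms(1) mult_1 power_add)
    qed
    moreover have "(z * q\<^sup>2) * (q\<^sup>2) ^ i = z * q ^ (2 * (i + 1))"
    proof -
      have "2 * (i + 1) = 2 + 2 * i"
        by simp
      then show ?thesis
        by (simp only: power_add power_mult mult.assoc)
    qed
    ultimately show "?f i = (z * q ^ (2 * (i + 1))) * (1 + z' * q ^ (2 * (M - 1 - i)))"
      by (simp add: algebra_simps)
  qed simp
  also have "\<dots> = z ^ M * q ^ (M * (M + 1)) * (\<Prod>i<M. 1 + z' * q ^ (2 * (M - 1 - i)))"
  proof -
    have "(\<Sum>i<M. 2 * (i + 1)) = M * (M + 1)"
      by (induction M) auto
    then show ?thesis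
      by (simp only: prod.distrib power_sum [symmetric] prod_constant card_lessThan)
  qed
  also have "(\<Prod>i<M. 1 + z' * q ^ (2 * (M - 1 - i))) = (\<Prod>i<M. 1 + z' * q ^ (2 * i))"
    by (subst prod.nat_diff_reindex [symmetric]) simp
  finally have lower: "(\<Prod>i<M. ?f i) = z ^ M * q ^ (M * (M + 1)) * (\<Prod>i<M. 1 + z' * q ^ (2 * i))" .
  \<comment> \<open>In the upper half the constant \<open>q ^ (2 * M)\<close> is pulled out instead,
    which leaves the factors with \<open>z\<close>. The two halves contribute M (M + 1) and 2 M M to
    the common power of \<open>q\<close>.\<close>
  have "(\<Prod>i<M. ?f (i + M)) = (\<Prod>i<M. q ^ (2 * M) * (1 + z * q ^ (2 * (i + 1))))"
  proof (rule prod.cong)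
    fix i :: nat
    have "2 + 2 * (i + M) = 2 * M + 2 * (i + 1)"
      by simp
    then have "q\<^sup>2 * (q\<^sup>2) ^ (i + M) = q ^ (2 * M) * q ^ (2 * (i + 1))"
      by (simp only: power_add [symmetric] power_mult [symmetric])
    then show "?f (i + M) = q ^ (2 * M) * (1 + z * q ^ (2 * (i + 1)))"
      by (simp only: mult.assoc distrib_left mult_1_right mult.left_commute[of z])
  qed simp
  also have "\<dots> = q ^ (2 * M * M) * (\<Prod>i<M. 1 + z * q ^ (2 * (i + 1)))"
    by (simp only: prod.distrib prod_constant card_lessThan power_mult)
  finally have upper: "(\<Prod>i<M. ?f (i + M)) = q ^ (2 * M * M) * (\<Prod>i<M. 1 + z * q ^ (2 * (i + 1)))" .
  have "q ^ (3 * M * M + M) * (z ^ M * ((\<Prod>i<M. 1 + z * q ^ (2 * (i + 1))) * (\<Prod>i<M. 1 + z' * q ^ (2 * i))))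
      = (\<Prod>i<M. ?f i) * (\<Prod>i<M. ?f (i + M))"
  proof -
    have e: "q ^ (3 * M * M + M) = q ^ (M * (M + 1)) * q ^ (2 * M * M)"
      by (simp add: power_add [symmetric] algebra_simps)
    show ?thesis
      unfolding lower upper e by (simp only: mult_ac)
  qed
  also have "\<dots> = (\<Prod>i<2*M. ?f i)"
  proof -
    have "(\<Prod>i<M. ?f (i + M)) = (\<Prod>i\<in>{M..<2*M}. ?f i)"
      by (rule prod.reindex_bij_witness[of _ "\<lambda>i. i - M" "\<lambda>i. i + M"]) auto
    moreover have "(\<Prod>i\<in>{..<M} \<union> {M..<2*M}. ?f i) = (\<Prod>i<M. ?f i) * (\<Prod>i\<in>{M..<2*M}. ?f i)"
      by (rule prod.union_disjoint) auto
    moreover have "{..<M} \<union> {M..<2*M} = {..<2*M}"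
      by auto
    ultimately show ?thesis
      by simp
  qed
  also have "\<dots> = (\<Sum>k\<le>2*M. qbinomial (q\<^sup>2) (2 * M) k * q ^ (k * (k - 1)) * (z * q\<^sup>2) ^ k * (q ^ (2 * M)) ^ (2 * M - k))"
    by (rule qbinomial_theorem)
  also have "\<dots> = (\<Sum>k\<le>2*M. q ^ (3 * M * M + M) * (qbinomial (q\<^sup>2) (2 * M) k * z ^ k * q ^ shifted_exponent M k))"
  proof (rule sum.cong)
    fix k assume k: "k \<in> {..2*M}"
    \<comment> \<open>Completing the square in k - M; passing to \<open>int\<close> avoids truncated
      subtraction.\<close>
    have "int (k * (k - 1) + 2 * k + 2 * M * (2 * M - k)) = int (3 * M * M + M + shifted_exponent M k)"
      unfolding of_nat_add of_nat_mult int_shifted_exponent using k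
      by (cases k) (auto simp: of_nat_diff algebra_simps)
    then have "q ^ (k * (k - 1)) * (q\<^sup>2) ^ k * (q ^ (2 * M)) ^ (2 * M - k)
             = q ^ (3 * M * M + M) * q ^ shifted_exponent M k"
      unfolding power_mult [symmetric] power_add [symmetric] of_nat_eq_iff by simp
    then show "qbinomial (q\<^sup>2) (2 * M) k * q ^ (k * (k - 1)) * (z * q\<^sup>2) ^ k * (q ^ (2 * M)) ^ (2 * M - k) =
        q ^ (3 * M * M + M) * (qbinomial (q\<^sup>2) (2 * M) k * z ^ k * q ^ shifted_exponent M k)"
      by (simp add: power_mult_distrib mult_ac)
  qed simp
  finally show ?thesis
    unfolding sum_distrib_left [symmetric] using assms(2) by simp
qed

lemma fps_cong_qpoch:
  assumes "m \<le> n"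
  shows "fps_cong (Suc m) (qpoch (fps_X\<^sup>2) n :: 'a::comm_ring_1 fps) (qpoch (fps_X\<^sup>2) m)"
  unfolding qpoch_def
proof (rule fps_cong_prod_subset)
  fix i assume "i \<in> {1..n} - {1..m}"
  then show "fps_cong (Suc m) (1 - (fps_X\<^sup>2) ^ i :: 'a fps) 1"
    using fps_cong_one_minus[of "2 * i" "1::'a fps"] by (auto simp: power_mult elim!: fps_cong_mono)
qed (use assms in auto)

lemma qpoch_unit:
  obtains g :: "'a::field fps" where "qpoch (fps_X\<^sup>2) n * g = 1"
proof
  have "fps_nth (qpoch (fps_X\<^sup>2) n) 0 = (1::'a)"
    using fps_cong_qpoch[of 0 n] by (auto simp: fps_cong_def)
  then show "qpoch (fps_X\<^sup>2) n * inverse (qpoch (fps_X\<^sup>2) n :: 'a fps) = 1"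
    by (simp add: inverse_mult_eq_1')
qed

text \<open>Below degree \<open>c\<close> every \<open>qpoch\<close> with index at least
  \<open>c\<close> is the same series P, so the quotient formula reads C P P = P. As P is a unit, C
  P = 1: the Gaussian binomials with both arguments large tend to the reciprocal of the infinite
  product.\<close>

lemma fps_cong_qbinomial:
  assumes "c < a" "c < b" "c < n"
  shows "fps_cong c (qbinomial (fps_X\<^sup>2) (a + b) a * qpoch (fps_X\<^sup>2) n) (1 :: 'a::field fps)"
proof -
  let ?P = "\<lambda>n. qpoch (fps_X\<^sup>2) n :: 'a fps" and ?C = "qbinomial (fps_X\<^sup>2) (a + b) a :: 'a fps"
  have P: "fps_cong c (?P k) (?P c)" if "c < k" for k
    using fps_cong_qpoch[of c k] that by (auto elim: fps_cong_mono)
  obtain g where g: "?P c * g = 1"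
    by (rule qpoch_unit)
  have "fps_cong c (?C * ?P a * ?P b) (?C * ?P c * ?P c)"
    using assms by (intro fps_cong_mult P) auto
  moreover have "fps_cong c (?P (a + b)) (?P c)"
    using assms by (intro P) auto
  ultimately have "fps_cong c (?C * ?P c * ?P c) (?P c)"
    unfolding qbinomial_mult_qpoch by (blast intro: fps_cong_trans fps_cong_sym)
  then have "fps_cong c (?C * ?P c * ?P c * g) (?P c * g)"
    by (intro fps_cong_mult) auto
  moreover have "?C * ?P c * ?P c * g = ?C * ?P c * (?P c * g)"
    by (simp only: mult.assoc)
  ultimately have "fps_cong c (?C * ?P c) 1"
    by (simp add: g)
  moreover have "fps_cong c (?C * ?P n) (?C * ?P c)"
    using assms by (intro fps_cong_mult P) auto
  ultimately show ?thesis
    by (blast intro: fps_cong_trans)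
qed

text \<open>After multiplication by a nonzero constant, the product agrees up to degree
  \<open>N\<close> with a sum of terms \<open>(- w) ^ k\<close> times \<open>fps_X\<close> to an
  exponent t (t + 1), where t = k - L.\<close>

lemma triple_product_support:
  fixes w :: complex
  assumes w: "w \<noteq> 0" "w \<noteq> 1" and "N \<le> M"
    and N: "\<And>t::int. int N \<noteq> t * (t + 1)"
  shows "fps_nth (\<Prod>n=1..M. (1 - fps_X ^ (2 * n)) * (1 - fps_const w * fps_X ^ (2 * n)) * (1 - fps_const (inverse w) * fps_X ^ (2 * n))) N = 0"
proof -
  \<comment> \<open>A term of degree at most \<open>N\<close> has |k - L| \<le> N + 1. This
    \<open>L\<close> then makes \<open>k\<close>, \<open>2 * L - k\<close> and \<open>L\<close> all
    exceed \<open>Suc N\<close>, as \<open>fps_cong_qbinomial\<close> demands for that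
    precision.\<close>
  define L where "L = 2 * N + 3"
  let ?w = "fps_const w" and ?w' = "fps_const (inverse w)"
  let ?g = "\<lambda>n. (1 - fps_X ^ (2 * n)) * (1 - ?w * fps_X ^ (2 * n)) * (1 - ?w' * fps_X ^ (2 * n))"
  let ?U = "\<lambda>k. qbinomial (fps_X\<^sup>2) (2 * L) k * qpoch (fps_X\<^sup>2) L :: complex fps"
  let ?S = "\<Sum>k\<le>2*L. (- ?w) ^ k * (fps_X ^ shifted_exponent L k * ?U k)"
  have g1: "fps_cong n (?g n) 1" for n
    using fps_cong_one_minus[of "2 * n" 1]
    by (auto intro!: fps_cong_mult_one fps_cong_mono[OF fps_cong_one_minus, of n "2 * n"]
             elim: fps_cong_mono)
  have cong: "fps_cong (Suc N) (prod ?g {1..K}) (prod ?g {1..N})" if "N \<le> K" for K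
    by (rule fps_cong_prod_subset) (use that in \<open>auto intro!: fps_cong_mono[OF g1]\<close>)
  have "prod ?g {1..L} = qpoch (fps_X\<^sup>2) L * ((\<Prod>n=1..L. 1 - ?w * fps_X ^ (2 * n)) * (\<Prod>n=1..L. 1 - ?w' * fps_X ^ (2 * n)))"
    by (simp only: qpoch_def prod.distrib power_mult mult.assoc)
  also have "(\<Prod>n=1..L. 1 - ?w * fps_X ^ (2 * n)) = (\<Prod>i<L. 1 + (-?w) * fps_X ^ (2 * (i + 1)))"
    by (rule prod.reindex_bij_witness[of _ "\<lambda>i. i + 1" "\<lambda>i. i - 1"]) auto
  also have "(\<Prod>n=1..L. 1 - ?w' * fps_X ^ (2 * n)) = (\<Prod>i<L. 1 + (-?w') * fps_X ^ (2 * (i + 1)))"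
    by (rule prod.reindex_bij_witness[of _ "\<lambda>i. i + 1" "\<lambda>i. i - 1"]) auto
  finally have g: "prod ?g {1..L} = qpoch (fps_X\<^sup>2) L *
     ((\<Prod>i<L. 1 + (-?w) * fps_X ^ (2 * (i + 1))) * (\<Prod>i<L. 1 + (-?w') * fps_X ^ (2 * (i + 1))))" .
  \<comment> \<open>The finite identity has a factor of exponent 0 where the product starts at
    exponent 2. The constant 1 - \<open>inverse w\<close> makes up for it; it is nonzero because
    \<open>w\<close> \<noteq> 1, so it can be cancelled at the end.\<close>
  have shift: "(1 - ?w') * (\<Prod>i<L. 1 + (-?w') * fps_X ^ (2 * (i + 1))) =
      (\<Prod>i<L. 1 + (-?w') * fps_X ^ (2 * i)) * (1 - ?w' * fps_X ^ (2 * L))"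
    using prod.lessThan_Suc_shift[of "\<lambda>i. 1 + (-?w') * fps_X ^ (2 * i)" L]
      prod.lessThan_Suc[of "\<lambda>i. 1 + (-?w') * fps_X ^ (2 * i)" L] by (simp del: fps_const_neg)
  have ww: "(-?w) * (-?w') = 1"
    using w by (simp add: fps_const_mult [symmetric])
  have "(-?w) ^ L * (1 - ?w') * prod ?g {1..L} =
      qpoch (fps_X\<^sup>2) L * ((-?w) ^ L * ((\<Prod>i<L. 1 + (-?w) * fps_X ^ (2 * (i + 1))) *
        ((1 - ?w') * (\<Prod>i<L. 1 + (-?w') * fps_X ^ (2 * (i + 1))))))"
    unfolding g by (simp only: mult_ac)
  also have "\<dots> = qpoch (fps_X\<^sup>2) L * ((-?w) ^ L * ((\<Prod>i<L. 1 + (-?w) * fps_X ^ (2 * (i + 1))) *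
        (\<Prod>i<L. 1 + (-?w') * fps_X ^ (2 * i)))) * (1 - ?w' * fps_X ^ (2 * L))"
    unfolding shift by (simp only: mult_ac)
  also have "\<dots> = ?S * (1 - ?w' * fps_X ^ (2 * L))"
    unfolding finite_triple_product[OF ww fps_X_neq_zero] sum_distrib_left
    by (rule arg_cong2[where f = "(*)"], rule sum.cong) (simp_all only: mult_ac)
  \<comment> \<open>The surplus top factor is 1 up to degree \<open>N\<close>, since
    \<open>2 * L\<close> exceeds \<open>N\<close>.\<close>
  finally have "fps_cong (Suc N) ((-?w) ^ L * (1 - ?w') * prod ?g {1..L}) (?S * 1)"
    by (simp only:, intro fps_cong_mult fps_cong_refl fps_cong_mono[OF fps_cong_one_minus]) (simp add: L_def)
  then have "fps_nth ((-?w) ^ L * (1 - ?w') * prod ?g {1..L}) N = fps_nth ?S N"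
    by (simp add: fps_cong_def)
  also have "(-?w) ^ L * (1 - ?w') = fps_const ((-w) ^ L * (1 - inverse w))"
    by (simp add: fps_const_mult [symmetric] fps_const_power [symmetric] fps_const_sub [symmetric] fps_const_neg [symmetric]
             del: fps_const_mult fps_const_power fps_const_sub fps_const_neg)
  also have "fps_nth ?S N = (\<Sum>k\<le>2*L. 0)"
    unfolding fps_sum_nth
  proof (rule sum.cong)
    fix k assume k: "k \<in> {..2*L}"
    define e where "e = shifted_exponent L k"
    have e: "int e = (int k - int L) * (int k - int L + 1)"
      by (simp add: e_def int_shifted_exponent)
    have "fps_nth (fps_X ^ e * ?U k) N = 0"
    proof (cases "e \<le> N")
      case True
      have "\<bar>int k - int L\<bar> \<le> int N + 1"
      proof (rule ccontr)
        assume "\<not> \<bar>int k - int L\<bar> \<le> int N + 1"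
        then consider "int k - int L \<ge> int N + 2" | "int k - int L + 1 \<le> - (int N + 1)"
          by linarith
        then have "int e \<ge> int N + 1"
        proof cases
          case 1
          then have "(int N + 2) * 1 \<le> int e"
            unfolding e by (intro mult_mono) auto
          then show ?thesis by simp
        next
          case 2
          then have "1 * (int N + 1) \<le> (- (int k - int L)) * (- (int k - int L + 1))"
            by (intro mult_mono) auto
          then show ?thesis unfolding e minus_mult_minus by simp
        qed
        with True show False by simp
      qed
      then have "fps_cong (Suc N) (qbinomial (fps_X\<^sup>2) (k + (2 * L - k)) k * qpoch (fps_X\<^sup>2) L) (1 :: complex fps)"
        using k by (intro fps_cong_qbinomial) (auto simp: L_def)
      \<comment> \<open>Up to degree \<open>N\<close> the term is the bare monomial of exponent
        \<open>e\<close>, which misses \<open>N\<close> by assumption.\<close>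
      then have "fps_nth (?U k) (N - e) = fps_nth (1 :: complex fps) (N - e)"
        using k by (simp add: fps_cong_def)
      moreover have "N \<noteq> e"
        using N[of "int k - int L"] e by auto
      ultimately show ?thesis
        using True by (simp add: fps_X_power_mult_nth)
    qed (simp add: fps_X_power_mult_nth)
    moreover have "(- ?w) ^ k = fps_const ((-w) ^ k)"
      by (simp add: fps_const_power [symmetric] fps_const_neg [symmetric]
             del: fps_const_power fps_const_neg)
    ultimately show "fps_nth ((- ?w) ^ k * (fps_X ^ shifted_exponent L k * ?U k)) N = 0"
      by (simp add: e_def)
  qed simp
  finally have "fps_nth (prod ?g {1..L}) N = 0"
    using w by simp
  then show ?thesis
    using cong[of L] cong[OF assms(3)] by (simp add: fps_cong_def L_def)
qed

section \<open>Counting coloured partitions\<close>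

text \<open>Parts come from an arbitrary set \<open>S\<close>, so that the generating function can
  be built by adding one coloured part to \<open>S\<close> at a time.\<close>

definition restricted_partitions :: "nat \<Rightarrow> (nat \<times> nat) set \<Rightarrow> nat \<Rightarrow> (nat \<times> nat) multiset set" where
  "restricted_partitions k S n =
    {M. set_mset M \<subseteq> S \<and> (\<forall>i c. k \<le> c \<longrightarrow> count M (i, c) \<le> 1) \<and> sum_mset (image_mset fst M) = n}"

lemma finite_restricted_partitions:
  assumes "finite S" "\<And>i c. (i, c) \<in> S \<Longrightarrow> 1 \<le> i"
  shows "finite (restricted_partitions k S n)"
proof (rule finite_subset)
  have "size M \<le> sum_mset (image_mset fst M)" if "set_mset M \<subseteq> S" for M
    using that
  proof (induction M)
    case (add x M)
    then show ?case using assms(2)[of "fst x" "snd x"] by auto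
  qed simp
  then show "restricted_partitions k S n \<subseteq> (\<Union>s\<le>n. {M. set_mset M \<subseteq> S \<and> size M = s})"
    by (auto simp: restricted_partitions_def)
  show "finite (\<Union>s\<le>n. {M. set_mset M \<subseteq> S \<and> size M = s})"
    using finite_multisets_of_size[OF assms(1)] by (auto simp: multisets_of_size_def)
qed

text \<open>Either the new part does not occur, or one copy of it is removed. In a colour with
  distinct parts it cannot occur again, so the rest lives in \<open>S\<close>; otherwise the rest
  may still contain it.\<close>

lemma restricted_partitions_insert:
  assumes "(i, c) \<notin> S"
  shows "restricted_partitions k (insert (i, c) S) n = restricted_partitions k S n \<union>
    (if n < i then {} else add_mset (i, c) ` restricted_partitions k (if k \<le> c then S else insert (i, c) S) (n - i))"
    (is "?A = ?B")
proof (intro equalityI subsetI)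
  fix M assume M: "M \<in> ?A"
  show "M \<in> ?B"
  proof (cases "(i, c) \<in># M")
    case True
    then obtain M' where M': "M = add_mset (i, c) M'"
      by (metis insert_DiffM)
    have "count M' (j, d) \<le> count M (j, d)" for j d
      by (simp add: M')
    then have "\<forall>j d. k \<le> d \<longrightarrow> count M' (j, d) \<le> 1"
      using M unfolding restricted_partitions_def by (blast intro: order_trans)
    moreover have "(i, c) \<notin># M'" if "k \<le> c"
    proof -
      have "count M (i, c) \<le> 1"
        using M that by (auto simp: restricted_partitions_def)
      then show ?thesis
        by (simp add: M' count_eq_zero_iff [symmetric] del: count_eq_zero_iff)
    qed
    ultimately have "M' \<in> restricted_partitions k (if k \<le> c then S else insert (i, c) S) (n - i)"
      using M by (auto simp: restricted_partitions_def M')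
    then show ?thesis
      using M by (auto simp: restricted_partitions_def M')
  next
    case False
    then show ?thesis
      using M by (auto simp: restricted_partitions_def)
  qed
next
  fix M assume M: "M \<in> ?B"
  then consider "M \<in> restricted_partitions k S n"
    | M' where "\<not> n < i" "M = add_mset (i, c) M'" "M' \<in> restricted_partitions k (if k \<le> c then S else insert (i, c) S) (n - i)"
    by (auto split: if_splits)
  then show "M \<in> ?A"
  proof cases
    case 2
    then have "(i, c) \<notin># M'" if "k \<le> c"
      using that assms by (auto simp: restricted_partitions_def)
    then have "\<forall>j d. k \<le> d \<longrightarrow> count M (j, d) \<le> 1"
      using 2 by (auto simp: restricted_partitions_def count_eq_zero_iff)
    then show ?thesis
      using 2 by (auto simp: restricted_partitions_def split: if_splits)
  qed (auto simp: restricted_partitions_def)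
qed

lemma card_restricted_partitions_insert:
  assumes "finite S" "\<And>i c. (i, c) \<in> S \<Longrightarrow> 1 \<le> i" "1 \<le> i" "(i, c) \<notin> S"
  shows "card (restricted_partitions k (insert (i, c) S) n) = card (restricted_partitions k S n) +
    (if n < i then 0 else card (restricted_partitions k (if k \<le> c then S else insert (i, c) S) (n - i)))"
proof -
  have fin: "finite (restricted_partitions k T m)" if "T = S \<or> T = insert (i, c) S" for T m
    using that assms by (intro finite_restricted_partitions) auto
  have "restricted_partitions k S n \<inter> add_mset (i, c) ` X = {}" for X
    using assms(4) by (auto simp: restricted_partitions_def)
  moreover have "card (add_mset (i, c) ` X) = card X" for X :: "(nat \<times> nat) multiset set"
    by (rule card_image) (auto simp: inj_on_def)
  ultimately show ?thesis
    unfolding restricted_partitions_insert[OF assms(4)]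
    by (subst card_Un_disjoint) (auto intro!: fin)
qed

definition part_series :: "nat \<Rightarrow> nat \<times> nat \<Rightarrow> complex fps" where
  "part_series k = (\<lambda>(i, c). if k \<le> c then 1 + fps_X ^ i else inverse (1 - fps_X ^ i))"

lemma restricted_partitions_series:
  assumes "finite S" "\<And>i c. (i, c) \<in> S \<Longrightarrow> 1 \<le> i"
  shows "Abs_fps (\<lambda>n. of_nat (card (restricted_partitions k S n))) = (\<Prod>s\<in>S. part_series k s)"
  using assms
proof (induction S rule: finite_induct)
  case empty
  have "restricted_partitions k {} n = (if n = 0 then {{#}} else {})" for n
    by (auto simp: restricted_partitions_def)
  then show ?case
    by (auto simp: fps_eq_iff)
next
  case (insert s S)
  obtain i c where s: "s = (i, c)"
    by (cases s)
  let ?G = "\<lambda>S. Abs_fps (\<lambda>n. of_nat (card (restricted_partitions k S n))) :: complex fps"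
  have i: "1 \<le> i"
    using insert.prems s by auto
  have "?G (insert s S) = ?G S + fps_X ^ i * ?G (if k \<le> c then S else insert s S)"
  proof -
    have "card (restricted_partitions k (insert s S) n) = card (restricted_partitions k S n) +
        (if n < i then 0 else card (restricted_partitions k (if k \<le> c then S else insert s S) (n - i)))" for n
      using insert.hyps insert.prems i unfolding s by (intro card_restricted_partitions_insert) auto
    then show ?thesis
      by (simp add: fps_eq_iff fps_X_power_mult_nth)
  qed
  \<comment> \<open>For a repeatable part the recurrence has the unknown series on both sides; this
    makes it solvable.\<close>
  moreover have "fps_nth (1 - fps_X ^ i :: complex fps) 0 \<noteq> 0"
    using i by simp
  ultimately have "?G (insert s S) = part_series k s * ?G S"
  proof (cases "k \<le> c")
    case False
    assume *: "fps_nth (1 - fps_X ^ i :: complex fps) 0 \<noteq> 0"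
    assume "?G (insert s S) = ?G S + fps_X ^ i * ?G (if k \<le> c then S else insert s S)"
    with False have "(1 - fps_X ^ i) * ?G (insert s S) = ?G S"
      by (simp add: algebra_simps)
    then have "inverse (1 - fps_X ^ i) * (1 - fps_X ^ i) * ?G (insert s S) = inverse (1 - fps_X ^ i) * ?G S"
      by (simp only: mult.assoc)
    then show ?thesis
      using False by (simp only: inverse_mult_eq_1[OF *]) (simp add: part_series_def s)
  qed (simp add: part_series_def s algebra_simps)
  moreover have "?G S = (\<Prod>s\<in>S. part_series k s)"
    using insert.IH insert.prems by blast
  ultimately show ?case
    using insert.hyps by simp
qed

text \<open>No part exceeds the total, so finitely many coloured parts are enough.\<close>

lemma colored_partitions_eq_restricted:
  "colored_partitions k j n = restricted_partitions k ({1..n} \<times> {..<k+j}) n"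
proof -
  have "fst x \<le> sum_mset (image_mset fst M)" if "x \<in># M" for x :: "nat \<times> nat" and M
    using that by (metis image_eqI le_add1 multi_member_split image_mset_add_mset sum_mset.insert)
  then have "i \<le> sum_mset (image_mset fst M)" if "(i, c) \<in># M" for i c :: nat and M
    using that by force
  then show ?thesis
    unfolding colored_partitions_def restricted_partitions_def by (force simp: subset_iff)
qed

lemma num_colored_partitions_series:
  "of_nat (num_colored_partitions k j n) =
     fps_nth (\<Prod>i=1..n. (1 + fps_X ^ i) ^ j * inverse (1 - fps_X ^ i) ^ k :: complex fps) n"
proof -
  have "of_nat (num_colored_partitions k j n) =
     fps_nth (\<Prod>s\<in>{1..n} \<times> {..<k+j}. part_series k s) n"
    by (subst restricted_partitions_series [symmetric])
       (auto simp: num_colored_partitions_def colored_partitions_eq_restricted)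
  also have "(\<Prod>s\<in>{1..n} \<times> {..<k+j}. part_series k s) = (\<Prod>i=1..n. \<Prod>c<k+j. part_series k (i, c))"
    by (simp add: prod.cartesian_product)
  also have "\<dots> = (\<Prod>i=1..n. (1 + fps_X ^ i) ^ j * inverse (1 - fps_X ^ i) ^ k)"
  proof (rule prod.cong)
    fix i
    have "(\<Prod>c<k+j. part_series k (i, c)) = (\<Prod>c<k. part_series k (i, c)) * (\<Prod>c\<in>{k..<k+j}. part_series k (i, c))"
      by (subst prod.union_disjoint [symmetric]) (auto intro: prod.cong)
    then show "(\<Prod>c<k+j. part_series k (i, c)) = (1 + fps_X ^ i) ^ j * inverse (1 - fps_X ^ i) ^ k"
      by (simp add: part_series_def)
  qed simp
  finally show ?thesis .
qed

section \<open>The value at zeta = 1\<close>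

lemma odd_range_eq_image:
  "{a :: int. odd a \<and> 1 \<le> a \<and> a \<le> 2 * int n - 1} = (\<lambda>i. 2 * int i + 1) ` {..<n}"
proof (intro equalityI subsetI)
  fix a assume a: "a \<in> {a :: int. odd a \<and> 1 \<le> a \<and> a \<le> 2 * int n - 1}"
  then obtain b where "a = 2 * b + 1"
    by (auto elim: oddE)
  with a show "a \<in> (\<lambda>i. 2 * int i + 1) ` {..<n}"
    by (intro image_eqI[of _ _ "nat b"]) auto
qed auto

lemma card_odd_range: "card {a :: int. odd a \<and> 1 \<le> a \<and> a \<le> 2 * int n - 1} = n"
  unfolding odd_range_eq_image by (subst card_image) (auto simp: inj_on_def)

lemma odd_ge_3_obtain:
  assumes "odd l" "l \<ge> 3"
  obtains n :: nat where "l = 2 * n + 3"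
proof
  show "l = 2 * ((l - 3) div 2) + 3"
    using assms by presburger
qed

lemma crank_series_eval_1:
  assumes "odd l" "l \<ge> 3" "k = l * m + (l - 3)"
  shows "laurent_eval (fps_nth (crank_series l m) N) 1 = of_nat (num_colored_partitions k 3 N)"
proof -
  obtain n where n: "l = 2 * n + 3"
    using assms(1,2) by (rule odd_ge_3_obtain)
  have A: "card {a :: int. odd a \<and> 1 \<le> a \<and> a \<le> int l - 4} = n"
    using card_odd_range[of n] by (simp add: n)
  have "crank_factor l m 1 i = (1 + fps_X ^ i) ^ 3 * inverse (1 - fps_X ^ i) ^ k" for i
  proof -
    have "crank_den l m (\<lambda>a. fps_const (1 powi a)) fps_X i = (1 - fps_X ^ i :: complex fps) ^ k"
    proof -
      have "crank_den l m (\<lambda>a. fps_const (1 powi a)) fps_X i =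
          ((1 - fps_X ^ i :: complex fps) ^ 3) ^ m * (((1 - fps_X ^ i) ^ 2) ^ n) ^ (m + 1)"
        by (simp add: crank_den_def A power3_eq_cube power2_eq_square)
      also have "\<dots> = (1 - fps_X ^ i) ^ (3 * m + 2 * n * (m + 1))"
        by (simp only: power_mult power_add)
      \<comment> \<open>The number of linear factors in the denominator, with l = 2 n + 3; this
        count is the origin of \<open>k\<close>.\<close>
      also have "3 * m + 2 * n * (m + 1) = k"
        by (simp add: assms(3) n algebra_simps)
      finally show ?thesis .
    qed
    then show ?thesis
      by (simp add: crank_factor_def crank_num_def power3_eq_cube fps_inverse_power)
  qed
  then have "laurent_eval (fps_nth (crank_series l m) N) 1 =
      fps_nth (\<Prod>i\<le>N. (1 + fps_X ^ (Suc i)) ^ 3 * inverse (1 - fps_X ^ (Suc i)) ^ k) N"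
    using laurent_eval_crank_series[of 1 N N l m] by simp
  also have "(\<Prod>i\<le>N. (1 + fps_X ^ (Suc i)) ^ 3 * inverse (1 - fps_X ^ (Suc i)) ^ k :: complex fps) =
      (\<Prod>i=1..Suc N. (1 + fps_X ^ i) ^ 3 * inverse (1 - fps_X ^ i) ^ k)"
    by (rule prod.reindex_bij_witness[of _ "\<lambda>i. i - 1" Suc]) auto
  also have "fps_nth \<dots> N = of_nat (num_colored_partitions k 3 N)"
  proof -
    \<comment> \<open>The truncated crank has one factor more than the partition product; the factor
      of index \<open>Suc N\<close> does not affect coefficient \<open>N\<close>.\<close>
    have "fps_cong (Suc N) (1 + fps_X ^ (Suc N) :: complex fps) 1" "fps_cong (Suc N) (1 - fps_X ^ (Suc N) :: complex fps) 1"
      using fps_cong_one_plus[of "Suc N" "1::complex fps"] fps_cong_one_minus[of "Suc N" "1::complex fps"] by simp_all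
    moreover have "(1 - fps_X ^ (Suc N) :: complex fps) * inverse (1 - fps_X ^ (Suc N)) = 1"
      by (rule inverse_mult_eq_1') simp
    ultimately have "fps_cong (Suc N) ((1 + fps_X ^ (Suc N)) ^ 3 * inverse (1 - fps_X ^ (Suc N)) ^ k :: complex fps) 1"
      by (intro fps_cong_mult_one fps_cong_power_one) (auto intro: fps_cong_right_factor_one)
    then have "fps_cong (Suc N) (\<Prod>i=1..Suc N. (1 + fps_X ^ i) ^ 3 * inverse (1 - fps_X ^ i) ^ k :: complex fps)
        (\<Prod>i=1..N. (1 + fps_X ^ i) ^ 3 * inverse (1 - fps_X ^ i) ^ k)"
      by (intro fps_cong_prod_subset) (auto simp: atLeastAtMostSuc_conv)
    then show ?thesis
      by (simp add: num_colored_partitions_series fps_cong_def)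
  qed
  finally show ?thesis .
qed

section \<open>The crank series at roots of unity\<close>

text \<open>By Bezout d x = l y + 1, so \<open>w\<close> = \<open>w ^ (l * y + 1)\<close> =
  \<open>w ^ (d * x)\<close> = 1.\<close>

lemma unity_root_coprime_power_eq_1:
  fixes w :: "'a::field"
  assumes "coprime d l" "w ^ l = 1" "w ^ d = 1"
  shows "w = 1"
proof (cases "l = 1")
  case False
  obtain x y where xy: "d * x = l * y + 1"
    using coprime_bezout_strong[OF assms(1) False] by blast
  have "w ^ (d * x) = 1" "w ^ (l * y + 1) = w"
    using assms by (simp_all add: power_mult power_add)
  then show ?thesis
    unfolding xy by simp
qed (use assms in auto)

lemma inj_on_unity_root_powers:
  fixes w :: "'a::field"
  assumes "prime l" "w ^ l = 1" "w \<noteq> 1"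
  shows "inj_on (\<lambda>j. w ^ j) {..<l}"
proof -
  have w0: "w \<noteq> 0"
    using assms by (metis power_0_left not_prime_0 zero_neq_one)
  have "i = j" if "w ^ i = w ^ j" "i \<le> j" "j < l" for i j
  proof (rule ccontr)
    assume "i \<noteq> j"
    have "w ^ (i + (j - i)) = w ^ i * w ^ (j - i)"
      by (rule power_add)
    then have "w ^ (j - i) = 1"
      using that w0 by simp
    moreover have "\<not> l dvd (j - i)"
      using that \<open>i \<noteq> j\<close> by (auto dest!: dvd_imp_le)
    then have "coprime (j - i) l"
      using prime_imp_coprime[OF assms(1)] coprime_commute by blast
    ultimately show False
      using unity_root_coprime_power_eq_1 assms by blast
  qed
  then show ?thesis
    by (intro linorder_inj_onI) force+
qed

text \<open>As polynomials in \<open>u\<close> both sides have degree at most \<open>l\<close> and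
  agree at \<open>l + 1\<close> points: 0 and the powers of \<open>w\<close>. The setting is an
  integral domain because \<open>u\<close> will be a power of \<open>fps_X\<close>.\<close>

lemma prod_one_minus_unity_roots:
  fixes w u :: "'a::idom"
  assumes "l > 0" "w ^ l = 1" "inj_on (\<lambda>j. w ^ j) {..<l}"
  shows "(\<Prod>j<l. 1 - w ^ j * u) = 1 - u ^ l"
proof -
  let ?p = "\<Prod>j<l. [:1, - (w ^ j):]" and ?q = "1 - Polynomial.monom 1 l :: 'a poly"
  have w0: "w \<noteq> 0"
    using assms(1,2) by (auto simp: power_0_left)
  have "?p = ?q"
  proof (rule poly_eqI_degree)
    fix x assume x: "x \<in> insert 0 ((\<lambda>j. w ^ j) ` {..<l})"
    show "poly ?p x = poly ?q x"
    proof (cases "x = 0")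
      case True
      then show ?thesis
        using assms(1) by (simp add: poly_prod poly_monom power_0_left)
    next
      case False
      then obtain i where i: "i < l" "x = w ^ i"
        using x by auto
      \<comment> \<open>The factor that vanishes at \<open>w ^ i\<close> belongs to the inverse
        power of \<open>w\<close>.\<close>
      define j where "j = (if i = 0 then 0 else l - i)"
      have j: "j < l" "w ^ i * w ^ j = 1"
        using i assms by (auto simp: j_def power_add [symmetric])
      have "poly ?p x = 0"
        unfolding poly_prod using j i by (intro prod_zero) (auto intro!: bexI[of _ j])
      moreover have "(w ^ i) ^ l = 1"
        by (metis assms(2) power_mult power_one mult.commute)
      ultimately show ?thesis
        by (simp add: poly_monom i)
    qed
  next
    have card: "card (insert 0 ((\<lambda>j. w ^ j) ` {..<l})) = Suc l"
      using w0 by (subst card_insert_disjoint) (auto simp: card_image[OF assms(3)])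
    have "Polynomial.degree ?p \<le> (\<Sum>j<l. Polynomial.degree [:1, - (w ^ j):])"
      using degree_prod_sum_le[of "{..<l}" "\<lambda>j. [:1, - (w ^ j):]"] by simp
    also have "\<dots> \<le> (\<Sum>j<l. 1)"
      by (intro sum_mono) simp
    finally show "Polynomial.degree ?p < card (insert 0 ((\<lambda>j. w ^ j) ` {..<l}))"
      by (simp add: card)
    have "Polynomial.degree ?q \<le> l"
      by (rule Polynomial.degree_diff_le) (simp_all add: Polynomial.degree_monom_le)
    then show "Polynomial.degree ?q < card (insert 0 ((\<lambda>j. w ^ j) ` {..<l}))"
      by (simp add: card)
  qed
  from arg_cong[OF this, of "\<lambda>p. poly p u"] show ?thesis
    by (simp add: poly_prod poly_monom mult.commute)
qed

text \<open>\<open>E\<close> is the missing copy of the exponents 0 and \<plusminus>(l - 2); with it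
  each residue modulo \<open>l\<close> occurs exactly \<open>m + 1\<close> times.\<close>

lemma crank_den_at_unity_root:
  fixes w :: complex
  assumes "prime l" "odd l" "w ^ l = 1" "w \<noteq> 1"
  defines "E \<equiv> \<lambda>n. (1 - fps_X ^ n) * (1 - fps_const (w powi (int l - 2)) * fps_X ^ n) *
      (1 - fps_const (w powi (- (int l - 2))) * fps_X ^ n)"
  shows "crank_den l m (\<lambda>a. fps_const (w powi a)) fps_X n * E n = (1 - (fps_X ^ n) ^ l) ^ (m + 1)"
proof -
  let ?u = "fps_X ^ n :: complex fps"
  let ?g = "\<lambda>a. 1 - fps_const (w powi a) * ?u" and ?h = "\<lambda>j. 1 - fps_const w ^ j * ?u"
  have "l \<noteq> 2"
    using assms(2) by auto
  then have "l \<ge> 3"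
    using prime_ge_2_nat[OF assms(1)] by linarith
  then obtain r where r: "l = 2 * r + 3"
    using assms(2) odd_ge_3_obtain by blast
  have w0: "w \<noteq> 0"
    using assms(3) r by (auto simp: power_0_left)
  have gh: "?g (int j) = ?h j" for j
    by (simp add: fps_const_power)
  have g_neg: "?g (- int j) = ?h (l - j)" if "j \<le> l" for j
  proof -
    have "w ^ (l - j) * w ^ j = 1"
      using that assms(3) by (simp add: power_add [symmetric])
    then have "w powi (- int j) = w ^ (l - j)"
      using w0 by (simp add: power_int_minus field_simps)
    then show ?thesis
      by (simp add: fps_const_power)
  qed
  have split: "(\<Prod>j<2*k+1. ?h j) = ?h 0 * ((\<Prod>i<k. ?h (2 * i + 1)) * (\<Prod>i<k. ?h (2 * i + 2)))" for k
    by (induction k) (simp_all add: mult_ac)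
  \<comment> \<open>Since \<open>l\<close> is odd, the negatives of 1, 3, ..., l - 2 are the even
    residues l - 1, ..., 4, 2, in reverse order.\<close>
  have "(\<Prod>i<r+1. ?g (- int (2 * i + 1))) = (\<Prod>i<r+1. ?h (2 * (r + 1 - Suc i) + 2))"
  proof (rule prod.cong)
    fix i assume i: "i \<in> {..<r+1}"
    then have "l - (2 * i + 1) = 2 * (r + 1 - Suc i) + 2"
      by (auto simp: r)
    then show "?g (- int (2 * i + 1)) = ?h (2 * (r + 1 - Suc i) + 2)"
      using i by (subst g_neg) (auto simp: r)
  qed simp
  also have "\<dots> = (\<Prod>i<r+1. ?h (2 * i + 2))"
    by (rule prod.nat_diff_reindex)
  finally have neg: "(\<Prod>i<r+1. ?g (- int (2 * i + 1))) = (\<Prod>i<r+1. ?h (2 * i + 2))" .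
  have "inj_on (\<lambda>j. fps_const w ^ j) {..<l}"
    using inj_on_unity_root_powers[OF assms(1,3,4)] by (auto simp: inj_on_def fps_const_power)
  then have "1 - ?u ^ l = (\<Prod>j<l. ?h j)"
    using prod_one_minus_unity_roots[of l "fps_const w" ?u] assms(3) r by (simp add: fps_const_power)
  also have "\<dots> = (1 - ?u) * ((\<Prod>i<r+1. ?g (int (2 * i + 1))) * (\<Prod>i<r+1. ?g (- int (2 * i + 1))))"
    unfolding neg gh using split[of "r + 1"] by (simp add: r eval_nat_numeral)
  also have "\<dots> = (\<Prod>i<r. ?g (int (2 * i + 1)) * ?g (- int (2 * i + 1))) *
      ((1 - ?u) * ?g (int (2 * r + 1)) * ?g (- int (2 * r + 1)))"
    by (simp only: Suc_eq_plus1 [symmetric] prod.lessThan_Suc prod.distrib mult_ac)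
  also have "(1 - ?u) * ?g (int (2 * r + 1)) * ?g (- int (2 * r + 1)) = E n"
    by (simp add: E_def r)
  also have "(\<Prod>i<r. ?g (int (2 * i + 1)) * ?g (- int (2 * i + 1))) =
      (\<Prod>a | odd a \<and> 1 \<le> a \<and> a \<le> int l - 4. ?g a * ?g (- a))"
    using odd_range_eq_image[of r] by (simp add: r prod.reindex inj_on_def add.commute)
  finally have 1: "1 - ?u ^ l = (\<Prod>a | odd a \<and> 1 \<le> a \<and> a \<le> int l - 4. ?g a * ?g (- a)) * E n" .
  have "crank_den l m (\<lambda>a. fps_const (w powi a)) fps_X n =
      E n ^ m * (\<Prod>a | odd a \<and> 1 \<le> a \<and> a \<le> int l - 4. ?g a * ?g (- a)) ^ (m + 1)"
    by (simp add: crank_den_def E_def)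
  then show ?thesis
    unfolding 1 power_mult_distrib by (simp add: mult_ac)
qed

definition triple_factor :: "complex \<Rightarrow> nat \<Rightarrow> complex fps" where
  "triple_factor w n =
     (1 - fps_X ^ (2 * n)) * (1 - fps_const w * fps_X ^ (2 * n)) * (1 - fps_const (inverse w) * fps_X ^ (2 * n))"

lemma crank_factor_at_unity_root:
  fixes w :: complex
  assumes "prime l" "odd l" "w ^ l = 1" "w \<noteq> 1" "n > 0"
  shows "crank_factor l m w n * (1 - fps_X ^ (n * l)) ^ (m + 1) = triple_factor ((w powi (int l - 2))\<^sup>2) n"
proof -
  let ?Z = "\<lambda>a. fps_const (w powi a)"
  define E where "E = (1 - fps_X ^ n) * (1 - ?Z (int l - 2) * fps_X ^ n) * (1 - ?Z (- (int l - 2)) * fps_X ^ n)"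
  let ?den = "crank_den l m ?Z fps_X n"
  have "crank_factor l m w n * (1 - fps_X ^ (n * l)) ^ (m + 1) =
      crank_num l ?Z fps_X n * (inverse ?den * ?den) * E"
    using crank_den_at_unity_root[OF assms(1-4), of m n]
    by (simp add: crank_factor_def power_mult E_def mult.assoc)
  also have "inverse ?den * ?den = 1"
    using assms(5) by (intro inverse_mult_eq_1) (simp add: crank_den_nth_0)
  \<comment> \<open>Numerator and \<open>E\<close> pair up as (1 + y) (1 - y) = 1 -
    \<open>y ^ 2\<close>.\<close>
  also have "crank_num l ?Z fps_X n * 1 * E = (1 - (fps_X ^ n)\<^sup>2) * (1 - (?Z (int l - 2) * fps_X ^ n)\<^sup>2) *
      (1 - (?Z (- (int l - 2)) * fps_X ^ n)\<^sup>2)"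
    by (simp add: crank_num_def E_def power2_eq_square algebra_simps)
  also have "\<dots> = triple_factor ((w powi (int l - 2))\<^sup>2) n"
  proof -
    have pos: "(?Z (int l - 2))\<^sup>2 = fps_const ((w powi (int l - 2))\<^sup>2)"
      by (simp add: fps_const_power)
    have neg: "(?Z (- (int l - 2)))\<^sup>2 = fps_const (inverse ((w powi (int l - 2))\<^sup>2))"
      unfolding power_int_minus by (simp add: fps_const_power power_inverse)
    show ?thesis
      by (simp only: triple_factor_def power_mult_distrib pos neg power_mult [symmetric] mult.commute[of n 2])
  qed
  finally show ?thesis .
qed

section \<open>Series supported on multiples of \<open>l\<close>\<close>

lemma fps_support_multiples_mult:
  fixes f g :: "'a::comm_ring_1 fps"
  assumes "\<And>i. \<not> l dvd i \<Longrightarrow> fps_nth f i = 0" "\<And>i. \<not> l dvd i \<Longrightarrow> fps_nth g i = 0" "\<not> l dvd i"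
  shows "fps_nth (f * g) i = 0"
  unfolding fps_mult_nth
proof (rule sum.neutral, rule ballI)
  fix j assume "j \<in> {0..i}"
  then have "\<not> l dvd j \<or> \<not> l dvd (i - j)"
    using assms(3) dvd_add[of l j "i - j"] by auto
  then show "fps_nth f j * fps_nth g (i - j) = 0"
    using assms(1,2) by auto
qed

lemma fps_support_multiples_power:
  assumes "\<And>i. \<not> l dvd i \<Longrightarrow> fps_nth f i = 0" "\<not> l dvd i"
  shows "fps_nth (f ^ k :: 'a::comm_ring_1 fps) i = 0"
  using assms(2)
proof (induction k arbitrary: i)
  case (Suc k)
  then show ?case
    using fps_support_multiples_mult[of l f "f ^ k" i] assms(1) by simp
qed (auto simp: fps_one_nth intro!: gr0I)

lemma fps_support_multiples_prod:
  assumes "\<And>x i. x \<in> A \<Longrightarrow> \<not> l dvd i \<Longrightarrow> fps_nth (f x) i = 0" "\<not> l dvd i"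
  shows "fps_nth (\<Prod>x\<in>A. f x :: 'a::comm_ring_1 fps) i = 0"
  using assms
proof (induction A arbitrary: i rule: infinite_finite_induct)
  case (insert x A)
  then show ?case
    using fps_support_multiples_mult[of l "f x" "\<Prod>x\<in>A. f x" i] by simp
qed (auto simp: fps_one_nth intro!: gr0I)

text \<open>Coefficient \<open>i\<close> of \<open>f * h\<close> is coefficient \<open>i\<close> of
  \<open>f\<close> plus contributions of smaller indices in the same class modulo \<open>l\<close>,
  which vanish by induction. So \<open>h\<close> is cancelled without being inverted.\<close>

lemma fps_nth_eq_0_residue_class:
  fixes f h :: "'a::comm_ring_1 fps"
  assumes "\<And>i. \<not> l dvd i \<Longrightarrow> fps_nth h i = 0" "fps_nth h 0 = 1"
    and "\<And>i. i \<le> N \<Longrightarrow> [i = N] (mod l) \<Longrightarrow> fps_nth (f * h) i = 0"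
    and "i \<le> N" "[i = N] (mod l)"
  shows "fps_nth f i = 0"
  using assms(4,5)
proof (induction i rule: less_induct)
  case (less i)
  have "fps_nth f j * fps_nth h (i - j) = 0" if "j < i" for j
  proof (cases "l dvd (i - j)")
    case True
    then have "[j = i] (mod l)"
      using that by (metis cong_altdef_nat cong_sym less_imp_le)
    then show ?thesis
      using less.prems that less.IH[OF that] cong_trans[OF _ less.prems(2)] by simp
  qed (use assms(1) in auto)
  then have "fps_nth (f * h) i = fps_nth f i"
    using assms(2) by (simp add: fps_mult_nth sum.last_plus atLeast0AtMost lessThan_Suc_atMost [symmetric])
  then show ?case
    using assms(3) less.prems by simp
qed

lemma crank_series_eval_unity_root:
  fixes w :: complex
  assumes "prime l" "odd l" "w ^ l = 1" "w \<noteq> 1"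
    and N: "\<And>t::int. \<not> [int N = t * (t + 1)] (mod int l)"
  shows "laurent_eval (fps_nth (crank_series l m) N) w = 0"
proof -
  define w' where "w' = (w powi (int l - 2))\<^sup>2"
  have l2: "l \<ge> 2"
    using assms(1) by (rule prime_ge_2_nat)
  have w0: "w \<noteq> 0"
    using assms(3) l2 by (auto simp: power_0_left)
  have "w' \<noteq> 1"
  proof
    assume "w' = 1"
    have "w powi (int l - 2) = w ^ (l - 2)"
      using l2 by (metis of_nat_diff of_nat_numeral power_int_of_nat)
    then have "w ^ (2 * (l - 2)) = 1"
      using \<open>w' = 1\<close> by (simp add: w'_def power_mult mult.commute[of 2])
    \<comment> \<open>\<open>w' = 1\<close> would give \<open>w ^ 4 = 1\<close>, which is impossible
      for a nontrivial root of odd order.\<close>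
    moreover have "w ^ 4 * w ^ (2 * (l - 2)) = (w ^ l) ^ 2"
      using l2 by (simp add: power_add [symmetric] power_mult [symmetric] algebra_simps)
    ultimately have "w ^ 4 = 1"
      using assms(3) by simp
    moreover have "coprime (2 ^ 2) l"
      using assms(2) by (simp only: coprime_power_left_iff) simp
    ultimately show False
      using unity_root_coprime_power_eq_1[of "2 ^ 2" l w] assms by simp
  qed
  have "w' \<noteq> 0"
    using w0 by (simp add: w'_def)
  let ?P = "\<Prod>n\<le>N. crank_factor l m w (Suc n)" and ?H = "\<Prod>n\<le>N. (1 - fps_X ^ (Suc n * l) :: complex fps) ^ (m + 1)"
  have "?P * ?H = (\<Prod>n\<le>N. triple_factor w' (Suc n))"
    unfolding w'_def by (simp only: prod.distrib [symmetric] crank_factor_at_unity_root[OF assms(1-4)] zero_less_Suc)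
  also have "\<dots> = (\<Prod>n=1..Suc N. triple_factor w' n)"
    by (rule prod.reindex_bij_witness[of _ "\<lambda>i. i - 1" Suc]) auto
  finally have PH: "?P * ?H = (\<Prod>n=1..Suc N. triple_factor w' n)" .
  have "fps_nth ?P N = 0"
  proof (rule fps_nth_eq_0_residue_class)
    show "fps_nth ?H i = 0" if "\<not> l dvd i" for i
      using that by (intro fps_support_multiples_prod[OF fps_support_multiples_power]) (auto simp: fps_one_nth intro!: gr0I)
    show "fps_nth ?H 0 = 1"
    proof -
      have "fps_cong 1 (1 - fps_X ^ (Suc n * l) :: complex fps) 1" for n
        using fps_cong_mono[OF fps_cong_one_minus[of "Suc n * l" "1 :: complex fps"], of 1] l2 by simp
      then have "fps_cong 1 ?H 1"
        by (intro fps_cong_prod_one fps_cong_power_one)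
      then show ?thesis
        by (simp add: fps_cong_def)
    qed
    \<comment> \<open>The hypothesis on \<open>N\<close> is a congruence, so it passes to every
      \<open>i\<close> in the class of \<open>N\<close>.\<close>
    show "fps_nth (?P * ?H) i = 0" if i: "i \<le> N" "[i = N] (mod l)" for i
      unfolding PH triple_factor_def
    proof (rule triple_product_support)
      show "int i \<noteq> t * (t + 1)" for t
        using N[of t] i(2) by (metis cong_int_iff cong_sym)
    qed (use \<open>w' \<noteq> 0\<close> \<open>w' \<noteq> 1\<close> i in auto)
  qed auto
  then show ?thesis
    using laurent_eval_crank_series[OF w0, of N N] by simp
qed

section \<open>Divisibility by the cyclotomic polynomial\<close>

lemma cis_power_unity_root: "cis (2 * pi * real j / real l) = cis (2 * pi / real l) ^ j"
  by (simp add: Complex.DeMoivre mult_ac)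

lemma cyclotomic_poly_prime:
  assumes "prime l"
  shows "cyclotomic_poly l = (\<Sum>i<l. Polynomial.monom 1 i)"
proof -
  let ?w = "cis (2 * pi / real l)"
  let ?S = "\<Sum>i<l. Polynomial.monom 1 i :: complex poly"
  have l2: "l \<ge> 2"
    using assms by (rule prime_ge_2_nat)
  have w: "?w ^ l = 1"
    using l2 by (simp add: cis_power_unity_root [symmetric] flip: cis_2pi)
  have "?w \<noteq> 1"
  proof
    assume "?w = 1"
    then have "cos (2 * pi / real l) = 1"
      by (simp add: complex_eq_iff)
    then obtain n :: int where n: "2 * pi / real l = real_of_int n * 2 * pi"
      by (auto simp: cos_one_2pi_int)
    then have "1 = real_of_int n * real l"
      using l2 by (simp add: field_simps)
    then have "1 = n * int l"
      by (metis of_int_1 of_int_eq_iff of_int_mult of_int_of_nat_eq)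
    then show False
      using l2 by (metis dvd_triv_right int_dvd_int_iff nat_dvd_1_iff_1 numeral_le_one_iff of_nat_1 semiring_norm(69))
  qed
  then have inj: "inj_on (\<lambda>j. ?w ^ j) {..<l}"
    using assms w by (intro inj_on_unity_root_powers)
  have set: "{j \<in> {1..l}. coprime j l} = {1..<l}"
  proof -
    have "coprime j l \<longleftrightarrow> j \<noteq> l" if "1 \<le> j" "j \<le> l" for j
    proof
      show "j \<noteq> l" if "coprime j l"
        using that l2 by auto
      assume "j \<noteq> l"
      then have "\<not> l dvd j"
        using that by (auto dest!: dvd_imp_le)
      then show "coprime j l"
        using prime_imp_coprime[OF assms] coprime_commute by blast
    qed
    then show ?thesis
      by (auto simp: less_le)
  qed
  \<comment> \<open>Both sides have degree at most \<open>l - 1\<close>, the same coefficient there,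
    and the same \<open>l - 1\<close> distinct zeros.\<close>
  have "(\<Prod>j\<in>{1..<l}. [:- (?w ^ j), 1:]) = ?S"
  proof (rule poly_eqI_degree_lead_coeff)
    show "Polynomial.coeff (\<Prod>j\<in>{1..<l}. [:- (?w ^ j), 1:]) (l - 1) = Polynomial.coeff ?S (l - 1)"
    proof -
      have "Polynomial.degree (\<Prod>j\<in>{1..<l}. [:- (?w ^ j), 1:]) = l - 1"
        by (subst degree_prod_eq_sum_degree) auto
      moreover have "lead_coeff (\<Prod>j\<in>{1..<l}. [:- (?w ^ j), 1:]) = 1"
        by (simp add: lead_coeff_prod)
      moreover have "Polynomial.coeff ?S (l - 1) = 1"
        using l2 by (simp add: Polynomial.coeff_sum)
      ultimately show ?thesis
        by simp
    qed
    show "Polynomial.degree (\<Prod>j\<in>{1..<l}. [:- (?w ^ j), 1:]) \<le> l - 1"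
      by (subst degree_prod_eq_sum_degree) auto
    show "Polynomial.degree ?S \<le> l - 1"
      by (rule Polynomial.degree_sum_le) (auto intro: order_trans[OF Polynomial.degree_monom_le])
    show "l - 1 \<le> card ((\<lambda>j. ?w ^ j) ` {1..<l})"
      using inj by (subst card_image) (auto intro: inj_on_subset)
  next
    fix z assume "z \<in> (\<lambda>j. ?w ^ j) ` {1..<l}"
    then obtain j where j: "j \<in> {1..<l}" "z = ?w ^ j"
      by auto
    have "z ^ l = 1"
      by (metis j(2) w power_mult power_one mult.commute)
    moreover have "z \<noteq> 1"
      using inj_onD[OF inj, of j 0] j by auto
    ultimately have "poly ?S z = 0"
      by (simp add: poly_sum poly_monom sum_gp_strict)
    moreover have "poly (\<Prod>j\<in>{1..<l}. [:- (?w ^ j), 1:]) z = 0"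
      unfolding poly_prod using j by (intro prod_zero) (auto intro!: bexI[of _ j])
    ultimately show "poly (\<Prod>j\<in>{1..<l}. [:- (?w ^ j), 1:]) z = poly ?S z"
      by simp
  qed
  then have prod: "(\<Prod>j | j \<in> {1..l} \<and> coprime j l. [:- cis (2 * pi * real j / real l), 1:]) = ?S"
    unfolding cis_power_unity_root set [symmetric] by simp
  show ?thesis
    unfolding cyclotomic_poly_def prod
  \<comment> \<open>The integer polynomial is unique because integers embed injectively into the
    complex numbers.\<close>
  proof (rule the_equality)
    show "map_poly of_int (\<Sum>i<l. Polynomial.monom 1 i) = ?S"
      by (rule poly_eqI) (simp add: coeff_map_poly Polynomial.coeff_sum)
  next
    fix f :: "int poly" assume f: "map_poly of_int f = ?S"
    show "f = (\<Sum>i<l. Polynomial.monom 1 i)"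
    proof (rule poly_eqI)
      fix n
      have "complex_of_int (Polynomial.coeff f n) = of_int (Polynomial.coeff (\<Sum>i<l. Polynomial.monom 1 i) n)"
        using arg_cong[OF f, of "\<lambda>p. Polynomial.coeff p n"] by (simp add: coeff_map_poly Polynomial.coeff_sum)
      then show "Polynomial.coeff f n = Polynomial.coeff (\<Sum>i<l. Polynomial.monom 1 i) n"
        by (simp only: of_int_eq_iff)
    qed
  qed
qed

section \<open>Integer polynomials inside the Laurent polynomials\<close>

lemma laurent_of_poly_superset:
  assumes "Polynomial.degree f \<le> n"
  shows "laurent_of_poly f = (\<Sum>i\<le>n. Poly_Mapping.single (int i) (Polynomial.coeff f i))"
  unfolding laurent_of_poly_def
  by (rule sum.mono_neutral_left) (use assms in \<open>auto simp: Polynomial.coeff_eq_0\<close>)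

lemma laurent_of_poly_add: "laurent_of_poly (f + g) = laurent_of_poly f + laurent_of_poly g"
proof -
  let ?n = "max (Polynomial.degree f) (Polynomial.degree g)"
  show ?thesis
    by (subst (1 2 3) laurent_of_poly_superset[of _ ?n])
       (auto simp: single_add sum.distrib Polynomial.degree_add_le)
qed

lemma laurent_of_poly_0 [simp]: "laurent_of_poly 0 = 0"
  by (simp add: laurent_of_poly_def)

lemma laurent_of_poly_sum: "laurent_of_poly (\<Sum>i\<in>A. f i) = (\<Sum>i\<in>A. laurent_of_poly (f i))"
  by (induction A rule: infinite_finite_induct) (auto simp: laurent_of_poly_add)

lemma laurent_of_poly_monom: "laurent_of_poly (Polynomial.monom c i) = Poly_Mapping.single (int i) c"
proof -
  have "laurent_of_poly (Polynomial.monom c i) =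
      (\<Sum>j\<le>i. Poly_Mapping.single (int j) (Polynomial.coeff (Polynomial.monom c i) j))"
    by (rule laurent_of_poly_superset) (rule Polynomial.degree_monom_le)
  also have "\<dots> = (\<Sum>j\<le>i. if j = i then Poly_Mapping.single (int i) c else 0)"
    by (rule sum.cong) auto
  finally show ?thesis
    by simp
qed

lemma laurent_of_poly_mult: "laurent_of_poly (f * g) = laurent_of_poly f * laurent_of_poly g"
proof -
  have monom: "laurent_of_poly (Polynomial.monom a i * Polynomial.monom b j) =
      laurent_of_poly (Polynomial.monom a i) * laurent_of_poly (Polynomial.monom b j)" for a b i j
    by (simp add: laurent_of_poly_monom Polynomial.mult_monom mult_single)
  show ?thesis
    by (subst (1 2) poly_as_sum_of_monoms[of f, symmetric], subst (1 2) poly_as_sum_of_monoms[of g, symmetric])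
       (simp only: sum_distrib_left sum_distrib_right laurent_of_poly_sum monom)
qed

lemma laurent_eval_laurent_of_poly: "laurent_eval (laurent_of_poly f) x = poly (map_poly of_int f) x"
  by (simp add: laurent_of_poly_def laurent_eval_sum poly_altdef coeff_map_poly degree_map_poly)

lemma laurent_eq_zeta_pow_mult_poly:
  obtains s f where "c = zeta_pow (- int s) * laurent_of_poly f"
proof
  \<comment> \<open>A crude bound for all exponents: shifting by the sum of their absolute values
    makes each nonnegative.\<close>
  define s where "s = nat (\<Sum>a\<in>Poly_Mapping.keys c. \<bar>a\<bar>)"
  have s: "0 \<le> a + int s" if "a \<in> Poly_Mapping.keys c" for a
  proof -
    have "\<bar>a\<bar> \<le> (\<Sum>a\<in>Poly_Mapping.keys c. \<bar>a\<bar>)"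
      using that by (intro member_le_sum) auto
    then show ?thesis
      unfolding s_def by linarith
  qed
  define f where "f = (\<Sum>a\<in>Poly_Mapping.keys c. Polynomial.monom (Poly_Mapping.lookup c a) (nat (a + int s)))"
  have "zeta_pow (- int s) * laurent_of_poly f =
      (\<Sum>a\<in>Poly_Mapping.keys c. Poly_Mapping.single a (Poly_Mapping.lookup c a))"
    unfolding f_def laurent_of_poly_sum sum_distrib_left
    by (rule sum.cong) (use s in \<open>auto simp: laurent_of_poly_monom zeta_pow_def mult_single\<close>)
  then show "c = zeta_pow (- int s) * laurent_of_poly f"
    using laurent_sum_singles[of c] by simp
qed

lemma cyclotomic_poly_dvd_laurent:
  assumes "prime l" "\<And>w. w ^ l = 1 \<Longrightarrow> w \<noteq> 1 \<Longrightarrow> laurent_eval c w = 0"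
  shows "laurent_of_poly (cyclotomic_poly l) dvd c"
proof -
  let ?\<Phi> = "\<Sum>i<l. Polynomial.monom 1 i :: int poly"
  have l2: "l \<ge> 2"
    using assms(1) by (rule prime_ge_2_nat)
  obtain s f where c: "c = zeta_pow (- int s) * laurent_of_poly f"
    by (rule laurent_eq_zeta_pow_mult_poly)
  have coeff: "Polynomial.coeff ?\<Phi> n = (if n < l then 1 else 0)" for n
    by (simp add: Polynomial.coeff_sum)
  have deg: "Polynomial.degree ?\<Phi> = l - 1"
    using l2 coeff by (intro antisym Polynomial.degree_le Polynomial.le_degree) auto
  \<comment> \<open>Pseudo-division by a polynomial with leading coefficient 1 is genuine division
    over the integers.\<close>
  obtain g r where gr: "pseudo_divmod f ?\<Phi> = (g, r)"
    by fastforce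
  have \<Phi>0: "?\<Phi> \<noteq> 0"
    using coeff[of 0] l2 by auto
  have f: "f = ?\<Phi> * g + r" and r: "r = 0 \<or> Polynomial.degree r < l - 1"
    using pseudo_divmod[OF \<Phi>0 gr] l2 by (simp_all add: deg coeff)
  \<comment> \<open>The remainder has degree below \<open>l - 1\<close> but vanishes at all
    \<open>l - 1\<close> nontrivial roots of unity.\<close>
  have "map_poly of_int r = (0 :: complex poly)"
  proof (rule poly_eqI_degree)
    fix w :: complex assume w: "w \<in> {w. w ^ l = 1} - {1}"
    then have w0: "w \<noteq> 0"
      using l2 by (auto simp: power_0_left)
    have "laurent_eval c w = 0"
      using w assms(2) by auto
    then have "laurent_eval (laurent_of_poly f) w = 0"
      using w0 by (simp add: c laurent_eval_mult)
    moreover have "laurent_eval (laurent_of_poly ?\<Phi>) w = 0"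
      using w by (simp add: laurent_of_poly_sum laurent_of_poly_monom laurent_eval_sum sum_gp_strict)
    ultimately show "poly (map_poly of_int r) w = poly 0 w"
      using w0 unfolding f by (simp add: laurent_of_poly_add laurent_of_poly_mult laurent_eval_add
          laurent_eval_mult laurent_eval_laurent_of_poly)
  next
    have "card ({w::complex. w ^ l = 1} - {1}) = l - 1"
      using l2 by (subst card_Diff_singleton) (auto simp: card_roots_unity_eq)
    then show "Polynomial.degree (map_poly of_int r :: complex poly) < card ({w::complex. w ^ l = 1} - {1})"
      "Polynomial.degree (0 :: complex poly) < card ({w::complex. w ^ l = 1} - {1})"
      using r l2 by (auto simp: degree_map_poly)
  qed
  then have "r = 0"
    by (simp add: poly_eq_iff coeff_map_poly)
  then show ?thesis
    unfolding c f cyclotomic_poly_prime[OF assms(1)] by (simp add: laurent_of_poly_mult)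
qed

text \<open>At 1 the cyclotomic polynomial takes the value \<open>l\<close>, and the cofactor takes
  an integer value.\<close>

lemma dvd_of_cyclotomic_dvd_laurent:
  assumes "prime l" "laurent_of_poly (cyclotomic_poly l) dvd c" "laurent_eval c 1 = of_nat p"
  shows "l dvd p"
proof -
  obtain d where d: "c = laurent_of_poly (cyclotomic_poly l) * d"
    using assms(2) by blast
  have "laurent_eval (laurent_of_poly (cyclotomic_poly l)) 1 = of_nat l"
    by (simp add: cyclotomic_poly_prime[OF assms(1)] laurent_of_poly_sum laurent_of_poly_monom laurent_eval_sum)
  moreover have "laurent_eval d 1 = of_int (\<Sum>a\<in>Poly_Mapping.keys d. Poly_Mapping.lookup d a)"
    by (simp add: laurent_eval_def)
  ultimately have "complex_of_int (int p) = of_int (int l * (\<Sum>a\<in>Poly_Mapping.keys d. Poly_Mapping.lookup d a))"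
    using assms(3) by (simp add: d laurent_eval_mult)
  then have "int p = int l * (\<Sum>a\<in>Poly_Mapping.keys d. Poly_Mapping.lookup d a)"
    by (simp only: of_int_eq_iff)
  then show ?thesis
    by (metis dvd_triv_left int_dvd_int_iff)
qed

section \<open>Convergence of the analytic product\<close>

text \<open>Uniform geometric approach to 1, the input of the Weierstrass test for products. It is
  stable under products, powers and, away from 0, inverses, so the linear factors decide.\<close>

definition geometric_to_one :: "'a set \<Rightarrow> real \<Rightarrow> (nat \<Rightarrow> 'a \<Rightarrow> complex) \<Rightarrow> bool" where
  "geometric_to_one S s f \<longleftrightarrow> (\<exists>C\<ge>0. \<forall>n. \<forall>q\<in>S. norm (f n q - 1) \<le> C * s ^ n)"

lemma geometric_to_one_1 [simp]: "geometric_to_one S s (\<lambda>n q. 1)"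
  unfolding geometric_to_one_def by (intro exI[of _ 0]) simp

lemma geometric_to_one_mult:
  assumes "0 \<le> s" "s \<le> 1" "geometric_to_one S s f" "geometric_to_one S s g"
  shows "geometric_to_one S s (\<lambda>n q. f n q * g n q)"
proof -
  obtain C D where C: "C \<ge> 0" "\<And>n q. q \<in> S \<Longrightarrow> norm (f n q - 1) \<le> C * s ^ n"
    and D: "D \<ge> 0" "\<And>n q. q \<in> S \<Longrightarrow> norm (g n q - 1) \<le> D * s ^ n"
    using assms(3,4) unfolding geometric_to_one_def by metis
  have "norm (f n q * g n q - 1) \<le> (C * D + C + D) * s ^ n" if q: "q \<in> S" for n q
  proof -
    have "f n q * g n q - 1 = (f n q - 1) * (g n q - 1) + (f n q - 1) + (g n q - 1)"
      by (simp add: algebra_simps)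
    then have "norm (f n q * g n q - 1) \<le> norm (f n q - 1) * norm (g n q - 1) + norm (f n q - 1) + norm (g n q - 1)"
      unfolding norm_mult [symmetric] by (simp only: norm_triangle_mono norm_triangle_ineq order_refl)
    also have "\<dots> \<le> (C * s ^ n) * D + C * s ^ n + D * s ^ n"
    proof -
      have "D * s ^ n \<le> D * 1"
        using assms D by (intro mult_left_mono power_le_one) auto
      then have "norm (g n q - 1) \<le> D"
        using D(2)[OF q, of n] by simp
      then have "norm (f n q - 1) * norm (g n q - 1) \<le> (C * s ^ n) * D"
        using C q assms by (intro mult_mono) auto
      then show ?thesis
        using C(2)[OF q, of n] D(2)[OF q, of n] by linarith
    qed
    finally show ?thesis
      by (simp add: algebra_simps)
  qed
  then show ?thesis
    unfolding geometric_to_one_def using C(1) D(1) by (intro exI[of _ "C * D + C + D"]) auto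
qed

lemma geometric_to_one_power:
  assumes "0 \<le> s" "s \<le> 1" "geometric_to_one S s f"
  shows "geometric_to_one S s (\<lambda>n q. f n q ^ k)"
proof (induction k)
  case (Suc k)
  show ?case
    unfolding power_Suc by (rule geometric_to_one_mult[OF assms Suc])
qed simp

lemma geometric_to_one_prod:
  assumes "0 \<le> s" "s \<le> 1" "\<And>x. x \<in> A \<Longrightarrow> geometric_to_one S s (f x)"
  shows "geometric_to_one S s (\<lambda>n q. \<Prod>x\<in>A. f x n q)"
  using assms(3)
proof (induction A rule: infinite_finite_induct)
  case (insert y A)
  then have "geometric_to_one S s (\<lambda>n q. f y n q * (\<Prod>x\<in>A. f x n q))"
    by (intro geometric_to_one_mult[OF assms(1,2)]) blast+
  then show ?case
    using insert.hyps by simp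
qed simp_all

lemma geometric_to_one_inverse:
  assumes "\<And>n q. q \<in> S \<Longrightarrow> norm (f n q) \<ge> d" "d > 0" "geometric_to_one S s f"
  shows "geometric_to_one S s (\<lambda>n q. inverse (f n q))"
proof -
  obtain C where C: "C \<ge> 0" "\<And>n q. q \<in> S \<Longrightarrow> norm (f n q - 1) \<le> C * s ^ n"
    using assms(3) unfolding geometric_to_one_def by metis
  have "norm (inverse (f n q) - 1) \<le> (C / d) * s ^ n" if q: "q \<in> S" for n q
  proof -
    have f: "norm (f n q) \<ge> d" "f n q \<noteq> 0"
      using assms(1)[OF q, of n] assms(2) by auto
    have "inverse (f n q) - 1 = - (f n q - 1) / f n q"
      using f by (simp add: field_simps)
    then have "norm (inverse (f n q) - 1) = norm (f n q - 1) / norm (f n q)"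
      by (simp add: norm_divide norm_minus_commute)
    also have "\<dots> \<le> (C * s ^ n) / d"
      using C(2)[OF q, of n] f assms(2) by (intro frac_le) (auto intro: order_trans[OF norm_ge_zero])
    finally show ?thesis by simp
  qed
  then show ?thesis
    unfolding geometric_to_one_def using C(1) assms(2) by (intro exI[of _ "C / d"]) auto
qed

lemma norm_prod_lower_bound:
  fixes f :: "'b \<Rightarrow> 'a::{real_normed_field}"
  assumes "0 \<le> d" "\<And>x. x \<in> A \<Longrightarrow> d \<le> norm (f x)"
  shows "d ^ card A \<le> norm (\<Prod>x\<in>A. f x)"
  using prod_mono[of A "\<lambda>_. d" "\<lambda>x. norm (f x)"] assms by (simp add: prod_norm)

lemma crank_den_as_prod:
  "crank_den l m Z q n =
    (1 - q ^ n) ^ m * (1 - Z (int l - 2) * q ^ n) ^ m * (1 - Z (- (int l - 2)) * q ^ n) ^ m *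
    (\<Prod>a | odd a \<and> 1 \<le> a \<and> a \<le> int l - 4. (1 - Z a * q ^ n) ^ (m + 1) * (1 - Z (- a) * q ^ n) ^ (m + 1))"
  by (simp only: crank_den_def power_mult_distrib prod_power_distrib prod.distrib)

text \<open>\<open>R\<close> is a radius for \<open>q\<close> below which every
  \<open>x powi a * q ^ n\<close> with |a| \<le> l - 2 and n \<ge> 1 has modulus less than 1. The
  two extreme exponents suffice, since the modulus of \<open>x powi a\<close> is monotone in
  \<open>a\<close>.\<close>

locale crank_disc =
  fixes l m :: nat and x :: complex and R :: real
  assumes x0: "x \<noteq> 0" and l3: "l \<ge> 3" and R0: "R > 0"
    and R: "norm (x powi (int l - 2)) * R \<le> 1" "norm (x powi (- (int l - 2))) * R \<le> 1"
begin

lemma norm_powi_le: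
  assumes "\<bar>a\<bar> \<le> int l - 2"
  shows "norm (x powi a) * R \<le> 1"
proof (cases "norm x \<ge> 1")
  case True
  have "norm (x powi a) \<le> norm (x powi (int l - 2))"
    unfolding norm_power_int using True assms by (intro power_int_increasing) auto
  then show ?thesis
    using R R0 by (meson mult_right_mono less_imp_le order_trans)
next
  case False
  have "norm (x powi a) \<le> norm (x powi (- (int l - 2)))"
    unfolding norm_power_int using False assms x0 by (intro power_int_decreasing) auto
  then show ?thesis
    using R R0 by (meson mult_right_mono less_imp_le order_trans)
qed

lemma R_le_1: "R \<le> 1"
  using norm_powi_le[of 0] l3 by simp

lemma norm_term_le:
  assumes "r < R" "norm q \<le> r" "\<bar>a\<bar> \<le> int l - 2"
  shows "norm (x powi a * q ^ Suc n) \<le> (r / R) ^ Suc n"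
proof -
  have r0: "0 \<le> r"
    using assms(2) by (rule order_trans[OF norm_ge_zero])
  have "norm (x powi a * q ^ Suc n) = norm (x powi a) * norm q ^ Suc n"
    by (simp add: norm_mult norm_power)
  also have "\<dots> \<le> (1 / R) * r ^ Suc n"
    using norm_powi_le[OF assms(3)] R0 assms(2) r0 by (intro mult_mono power_mono) (auto simp: field_simps)
  \<comment> \<open>Since \<open>R\<close> \<le> 1, the single factor 1 / R may be raised to a
    power, which yields a geometric bound of ratio r / R < 1.\<close>
  also have "\<dots> \<le> (1 / R) ^ Suc n * r ^ Suc n"
  proof -
    have "(1 / R) ^ 1 \<le> (1 / R) ^ Suc n"
      using R0 R_le_1 by (intro power_increasing) auto
    then show ?thesis
      using r0 by (intro mult_right_mono) auto
  qed
  finally show ?thesis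
    by (simp add: power_divide)
qed

abbreviation Z :: "int \<Rightarrow> complex" where "Z \<equiv> \<lambda>a. x powi a"

lemma geometric_linear_factor:
  assumes "0 \<le> r" "r < R" "\<bar>a\<bar> \<le> int l - 2"
  shows "geometric_to_one (cball 0 r) (r / R) (\<lambda>n q. 1 + Z a * q ^ Suc n)"
    and "geometric_to_one (cball 0 r) (r / R) (\<lambda>n q. 1 - Z a * q ^ Suc n)"
proof -
  have "norm (Z a * q ^ Suc n) \<le> (r / R) * (r / R) ^ n" if "q \<in> cball 0 r" for n q
    using norm_term_le[OF assms(2) _ assms(3), of q n] that by simp
  then show "geometric_to_one (cball 0 r) (r / R) (\<lambda>n q. 1 + Z a * q ^ Suc n)"
    "geometric_to_one (cball 0 r) (r / R) (\<lambda>n q. 1 - Z a * q ^ Suc n)"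
    unfolding geometric_to_one_def using assms R0 by (auto intro!: exI[of _ "r / R"])
qed

lemma geometric_linear_factor':
  assumes "0 \<le> r" "r < R"
  shows "geometric_to_one (cball 0 r) (r / R) (\<lambda>n q. 1 + q ^ Suc n)"
    and "geometric_to_one (cball 0 r) (r / R) (\<lambda>n q. 1 - q ^ Suc n)"
  using geometric_linear_factor[OF assms, of 0] l3 by simp_all

lemma norm_factor_ge:
  assumes "0 \<le> r" "r < R" "norm q \<le> r" "\<bar>a\<bar> \<le> int l - 2"
  shows "1 - r / R \<le> norm (1 - Z a * q ^ Suc n)"
proof -
  have "norm (Z a * q ^ Suc n) \<le> (r / R) ^ Suc n"
    using assms by (intro norm_term_le)
  also have "\<dots> \<le> (r / R) ^ 1"
    using assms R0 by (intro power_decreasing) auto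
  finally have *: "norm (Z a * q ^ Suc n) \<le> r / R"
    by simp
  show "1 - r / R \<le> norm (1 - Z a * q ^ Suc n)"
    using norm_triangle_ineq2[of 1 "Z a * q ^ Suc n"] * by simp
qed

lemma norm_factor_ge':
  fixes q :: complex
  assumes "0 \<le> r" "r < R" "norm q \<le> r"
  shows "1 - r / R \<le> norm (1 - q ^ Suc n)"
  using norm_factor_ge[OF assms, of 0 n] l3 by simp

lemma geometric_num:
  assumes "0 \<le> r" "r < R"
  shows "geometric_to_one (cball 0 r) (r / R) (\<lambda>n q. crank_num l Z q (Suc n))"
  unfolding crank_num_def using assms R0 l3
  by (intro geometric_to_one_mult geometric_linear_factor geometric_linear_factor') auto

lemma geometric_den:
  assumes "0 \<le> r" "r < R"
  shows "geometric_to_one (cball 0 r) (r / R) (\<lambda>n q. crank_den l m Z q (Suc n))"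
  unfolding crank_den_as_prod using assms R0 l3
  by (intro geometric_to_one_mult geometric_to_one_power geometric_to_one_prod
      geometric_linear_factor geometric_linear_factor') auto

lemma norm_den_ge:
  assumes "0 \<le> r" "r < R"
  obtains d where "d > 0" "\<And>n q. q \<in> cball 0 r \<Longrightarrow> d \<le> norm (crank_den l m Z q (Suc n))"
proof
  let ?s = "1 - r / R"
  let ?A = "{a::int. odd a \<and> 1 \<le> a \<and> a \<le> int l - 4}"
  let ?d = "?s ^ m * ?s ^ m * ?s ^ m * (?s ^ (m + 1) * ?s ^ (m + 1)) ^ card ?A"
  have s0: "?s > 0"
    using assms R0 by (simp add: field_simps)
  then show "?d > 0"
    by simp
  fix n q assume q: "q \<in> cball (0::complex) r"
  have f: "?s ^ k \<le> norm (1 - Z a * q ^ Suc n) ^ k" if "\<bar>a\<bar> \<le> int l - 2" for a k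
    using norm_factor_ge[OF assms _ that] q s0 by (intro power_mono) auto
  have f': "?s ^ k \<le> norm (1 - q ^ Suc n) ^ k" for k
    using norm_factor_ge'[OF assms] q s0 by (intro power_mono) auto
  have "(?s ^ (m + 1) * ?s ^ (m + 1)) ^ card ?A \<le>
      norm (\<Prod>a\<in>?A. (1 - Z a * q ^ Suc n) ^ (m + 1) * (1 - Z (- a) * q ^ Suc n) ^ (m + 1))"
  proof (rule norm_prod_lower_bound)
    fix a assume a: "a \<in> ?A"
    show "?s ^ (m + 1) * ?s ^ (m + 1) \<le> norm ((1 - Z a * q ^ Suc n) ^ (m + 1) * (1 - Z (- a) * q ^ Suc n) ^ (m + 1))"
      unfolding norm_mult norm_power using a s0 by (intro mult_mono f) auto
  qed (use s0 in simp)
  then show "?d \<le> norm (crank_den l m Z q (Suc n))"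
    unfolding crank_den_as_prod norm_mult norm_power using s0 l3
    by (intro mult_mono f f') auto
qed

definition factor :: "nat \<Rightarrow> complex \<Rightarrow> complex" where
  "factor n q = crank_num l Z q (Suc n) * inverse (crank_den l m Z q (Suc n))"

lemma geometric_factor:
  assumes "0 \<le> r" "r < R"
  shows "geometric_to_one (cball 0 r) (r / R) factor"
proof -
  obtain d where d: "d > 0" "\<And>n q. q \<in> cball 0 r \<Longrightarrow> d \<le> norm (crank_den l m Z q (Suc n))"
    using norm_den_ge[OF assms] by blast
  show ?thesis
    unfolding factor_def[abs_def] using assms R0
    by (intro geometric_to_one_mult geometric_num geometric_to_one_inverse[OF d(2) d(1)] geometric_den) auto
qed

lemma den_nonzero: "q \<in> ball 0 R \<Longrightarrow> crank_den l m Z q (Suc n) \<noteq> 0"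
  using norm_den_ge[of "norm q"]
  by (metis dist_0_norm mem_ball norm_ge_zero mem_cball order_refl norm_zero not_less)

lemma holomorphic_factor: "factor n holomorphic_on ball 0 R"
  unfolding factor_def[abs_def]
proof (intro holomorphic_intros)
  show "(\<lambda>q. crank_num l Z q (Suc n)) holomorphic_on ball 0 R"
    unfolding crank_num_def by (intro holomorphic_intros)
  show "(\<lambda>q. crank_den l m Z q (Suc n)) holomorphic_on ball 0 R"
    unfolding crank_den_def by (intro holomorphic_intros)
qed (use den_nonzero in auto)

lemma has_fps_expansion_factor: "factor n has_fps_expansion crank_factor l m x (Suc n)"
  unfolding factor_def[abs_def] crank_factor_def
proof (intro has_fps_expansion_mult has_fps_expansion_inverse)
  show "(\<lambda>q. crank_num l Z q (Suc n)) has_fps_expansion crank_num l (\<lambda>a. fps_const (Z a)) fps_X (Suc n)"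
    unfolding crank_num_def by (intro fps_expansion_intros)
  show "(\<lambda>q. crank_den l m Z q (Suc n)) has_fps_expansion crank_den l m (\<lambda>a. fps_const (Z a)) fps_X (Suc n)"
    unfolding crank_den_def by (intro fps_expansion_intros)
qed (simp add: crank_den_nth_0)

text \<open>The partial products converge locally uniformly, so the limit is holomorphic and its
  Taylor coefficients are the limits of theirs; those become stationary at the evaluated
  coefficients of \<open>crank_series\<close>.\<close>

lemma crank_sums:
  assumes q: "q \<in> ball 0 R"
  shows "(\<lambda>N. laurent_eval (fps_nth (crank_series l m) N) x * q ^ N) sums prodinf (\<lambda>n. factor n q)"
proof -
  define P where "P = (\<lambda>q. prodinf (\<lambda>n. factor n q))"
  have summ: "summable (\<lambda>n. norm (factor n q - 1))" if "q \<in> ball 0 R" for q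
  proof -
    have "geometric_to_one (cball 0 (norm q)) (norm q / R) factor"
      using that by (intro geometric_factor) auto
    then obtain C where C: "\<forall>n. \<forall>y\<in>cball 0 (norm q). norm (factor n y - 1) \<le> C * (norm q / R) ^ n"
      unfolding geometric_to_one_def by (elim exE conjE) (rule that)
    have "norm (factor n q - 1) \<le> C * (norm q / R) ^ n" for n
      using C[rule_format, of q n] by simp
    moreover have "summable (\<lambda>n. C * (norm q / R) ^ n)"
      using that R0 by (intro summable_mult summable_geometric) (auto simp: field_simps)
    ultimately show ?thesis
      using summable_comparison_test'[of "\<lambda>n. C * (norm q / R) ^ n" 0 "\<lambda>n. norm (factor n q - 1)"] by simp
  qed
  have lim: "(\<lambda>N. \<Prod>n<N. factor n q) \<longlonglongrightarrow> P q" if "q \<in> ball 0 R" for q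
  proof -
    have "convergent_prod (\<lambda>n. factor n q)"
      using summ[OF that] by (intro abs_convergent_prod_imp_convergent_prod summable_imp_abs_convergent_prod)
    then have "(\<lambda>N. \<Prod>n\<le>N. factor n q) \<longlonglongrightarrow> P q"
      unfolding P_def by (rule convergent_prod_LIMSEQ)
    then show ?thesis
      by (simp add: LIMSEQ_lessThan_iff_atMost)
  qed
  have unif: "uniform_limit (cball 0 r) (\<lambda>N q. \<Prod>n<N. factor n q) P sequentially" if r: "0 \<le> r" "r < R" for r
  proof -
    obtain C where C: "\<forall>n. \<forall>q\<in>cball 0 r. norm (factor n q - 1) \<le> C * (r / R) ^ n"
      using geometric_factor[OF r] unfolding geometric_to_one_def by blast
    have "uniformly_convergent_on (cball 0 r) (\<lambda>N q. \<Prod>n<N. factor n q)"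
    proof (rule uniformly_convergent_on_prod')
      show "continuous_on (cball 0 r) (factor n)" for n
        by (rule holomorphic_on_imp_continuous_on[OF holomorphic_on_subset[OF holomorphic_factor]]) (use r in auto)
      show "uniformly_convergent_on (cball 0 r) (\<lambda>N q. \<Sum>n<N. norm (factor n q - 1))"
      proof (rule Weierstrass_m_test')
        show "norm (norm (factor n q - 1)) \<le> C * (r / R) ^ n" if "q \<in> cball 0 r" for n q
          using C that by simp
        show "summable (\<lambda>n. C * (r / R) ^ n)"
          using r by (intro summable_mult summable_geometric) auto
      qed
    qed auto
    then obtain P' where P': "uniform_limit (cball 0 r) (\<lambda>N q. \<Prod>n<N. factor n q) P' sequentially"
      by (auto simp: uniformly_convergent_on_def)
    \<comment> \<open>The Weierstrass test gives some uniform limit; the pointwise limits identify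
      it with \<open>P\<close>.\<close>
    have "P' q = P q" if "q \<in> cball 0 r" for q
      using tendsto_uniform_limitI[OF P' that] lim[of q] that r by (auto intro: LIMSEQ_unique)
    then show ?thesis
      using P' by (metis (no_types, lifting) uniform_limit_cong')
  qed
  have hol_prod: "(\<lambda>q. \<Prod>n<N. factor n q) holomorphic_on ball 0 R" for N
    by (intro holomorphic_intros holomorphic_factor)
  have holP: "P holomorphic_on ball 0 R"
  proof (rule holomorphic_uniform_sequence[OF open_ball hol_prod])
    fix y :: complex assume y: "y \<in> ball 0 R"
    define d where "d = (R - norm y) / 2"
    have d: "d > 0" "norm y + d < R"
      using y by (auto simp: d_def field_simps)
    have sub: "cball y d \<subseteq> cball 0 (norm y + d)"
      by (simp add: cball_subset_cball_iff)
    moreover have "cball 0 (norm y + d) \<subseteq> ball (0::complex) R"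
      using d by auto
    moreover have "uniform_limit (cball y d) (\<lambda>N q. \<Prod>n<N. factor n q) P sequentially"
      using unif[of "norm y + d"] d sub by (auto intro: uniform_limit_on_subset)
    ultimately show "\<exists>d>0. cball y d \<subseteq> ball 0 R \<and> uniform_limit (cball y d) (\<lambda>N q. \<Prod>n<N. factor n q) P sequentially"
      using d by (intro exI[of _ d]) auto
  qed
  have P_exp: "P has_fps_expansion fps_expansion P 0"
    using holP R0 by (intro has_fps_expansion_fps_expansion[of "ball 0 R"]) auto
  let ?h = "Abs_fps (\<lambda>N. laurent_eval (fps_nth (crank_series l m) N) x)"
  have "fps_expansion P 0 = ?h"
  proof (rule uniform_limit_imp_fps_expansion_eq)
    show "(\<lambda>N. \<Prod>n<N. crank_factor l m x (Suc n)) \<longlonglongrightarrow> ?h"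
    proof (rule tendsto_fpsI)
      fix k
      show "\<forall>\<^sub>F N in sequentially. fps_nth (\<Prod>n<N. crank_factor l m x (Suc n)) k = fps_nth ?h k"
        using eventually_gt_at_top[of k]
      proof eventually_elim
        case (elim N)
        then show ?case
          using laurent_eval_crank_series[OF x0, of k "N - 1" l m] lessThan_Suc_atMost[of "N - 1"] by simp
      qed
    qed
    have "ball 0 (R / 2) \<subseteq> cball (0::complex) (R / 2)"
      by (rule ball_subset_cball)
    then show "uniform_limit (ball 0 (R / 2)) (\<lambda>N q. \<Prod>n<N. factor n q) P sequentially"
      using unif[of "R / 2"] R0 by (auto intro: uniform_limit_on_subset)
    show "\<forall>\<^sub>F N in sequentially. (\<lambda>q. \<Prod>n<N. factor n q) has_fps_expansion (\<Prod>n<N. crank_factor l m x (Suc n))"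
      by (intro always_eventually allI has_fps_expansion_prod has_fps_expansion_factor)
    show "\<forall>\<^sub>F N in sequentially. (\<lambda>q. \<Prod>n<N. factor n q) holomorphic_on ball 0 (R / 2)"
      using R0 by (intro always_eventually allI holomorphic_on_subset[OF hol_prod]) (auto intro: subset_ball)
  qed (use P_exp R0 in auto)
  then have "P has_fps_expansion ?h"
    using P_exp by simp
  then have "(\<lambda>N. fps_nth ?h N * q ^ N) sums P q"
    using holP q by (intro has_fps_expansion_imp_sums_complex[where r = "ereal R"]) (auto simp: eball_def)
  then show ?thesis
    by (simp add: P_def)
qed

end

lemma crank_series_sums:
  assumes "l \<ge> 3" "(real l - 2) * \<bar>Im z\<bar> < Im \<tau>"
  shows "(\<lambda>N. laurent_eval (fps_nth (crank_series l m) N) (exp (2 * pi * \<i> * z))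
               * exp (2 * pi * \<i> * \<tau>) ^ N) sums crank l m z \<tau>"
proof -
  define x where "x = exp (2 * pi * \<i> * z)"
  define q where "q = exp (2 * pi * \<i> * \<tau>)"
  \<comment> \<open>The minimum of the moduli of \<open>x powi a\<close> over |a| \<le> l - 2, so
    |q| < R is exactly the assumption on \<open>z\<close> and \<open>\<tau>\<close>.\<close>
  define R where "R = exp (- 2 * pi * (real l - 2) * \<bar>Im z\<bar>)"
  have norm_powi: "norm (x powi a) = exp (- 2 * pi * real_of_int a * Im z)" for a
  proof -
    have "x powi a = exp (of_int a * (2 * pi * \<i> * z))"
      unfolding x_def by (rule exp_power_int)
    then show ?thesis
      by (simp only: norm_exp_eq_Re) simp
  qed
  have bound: "norm (x powi a) * R \<le> 1" if "\<bar>real_of_int a\<bar> = real l - 2" for a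
  proof -
    have "- (real_of_int a * Im z) \<le> (real l - 2) * \<bar>Im z\<bar>"
      by (metis abs_ge_minus_self abs_mult that)
    then have "2 * pi * (- (real_of_int a * Im z)) \<le> 2 * pi * ((real l - 2) * \<bar>Im z\<bar>)"
      by (intro mult_left_mono) auto
    then show ?thesis
      by (simp add: norm_powi R_def exp_add [symmetric] algebra_simps)
  qed
  interpret crank_disc l m x R
  proof
    show "norm (x powi (int l - 2)) * R \<le> 1" "norm (x powi (- (int l - 2))) * R \<le> 1"
      using assms(1) by (auto intro!: bound)
  qed (use assms(1) in \<open>auto simp: x_def R_def\<close>)
  have "norm q = exp (- 2 * pi * Im \<tau>)"
    by (simp add: q_def norm_exp_eq_Re)
  also have "\<dots> < R"
    using mult_strict_left_mono[OF assms(2), of "2 * pi"] by (simp add: R_def mult.assoc)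
  finally have "q \<in> ball 0 R"
    by simp
  then show ?thesis
    using crank_sums[of q]
    unfolding crank_def Let_def x_def [symmetric] q_def [symmetric] divide_inverse factor_def by simp
qed

theorem theorem1p2:
  fixes l m k :: nat
  assumes "prime l" and "odd l" and "k = l * m + (l - 3)"
  shows
    "(\<forall>z \<tau> :: complex. (real l - 2) * \<bar>Im z\<bar> < Im \<tau> \<longrightarrow>
        (\<lambda>N. laurent_eval (fps_nth (crank_series l m) N) (exp (2 * pi * \<i> * z))
               * exp (2 * pi * \<i> * \<tau>) ^ N) sums crank l m z \<tau>)
     \<and> Abs_fps (\<lambda>N. laurent_eval (fps_nth (crank_series l m) N) 1)
         = Abs_fps (\<lambda>N. of_nat (num_colored_partitions k 3 N))
     \<and> (\<forall>\<delta> :: int. \<not> QuadRes (int l) (4 * \<delta> + 1) \<longrightarrow>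
          (\<forall>n :: nat. 0 \<le> int l * int n + \<delta> \<longrightarrow>
             (let N = nat (int l * int n + \<delta>); c = fps_nth (crank_series l m) N
              in laurent_of_poly (cyclotomic_poly l) dvd c
                 \<and> laurent_eval c (exp (2 * pi * \<i> / l)) = 0
                 \<and> [num_colored_partitions k 3 N = 0] (mod l))))"
proof (intro conjI allI impI)
  have "l \<noteq> 2"
    using assms(2) by auto
  then have l3: "l \<ge> 3"
    using prime_ge_2_nat[OF assms(1)] by linarith
  show "(\<lambda>N. laurent_eval (fps_nth (crank_series l m) N) (exp (2 * pi * \<i> * z))
               * exp (2 * pi * \<i> * \<tau>) ^ N) sums crank l m z \<tau>"
    if "(real l - 2) * \<bar>Im z\<bar> < Im \<tau>" for z \<tau>
    using l3 that by (rule crank_series_sums)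
  note eval_1 = crank_series_eval_1[OF assms(2) l3 assms(3)]
  show "Abs_fps (\<lambda>N. laurent_eval (fps_nth (crank_series l m) N) 1)
         = Abs_fps (\<lambda>N. of_nat (num_colored_partitions k 3 N))"
    by (simp add: eval_1)
  fix \<delta> :: int and n :: nat
  assume \<delta>: "\<not> QuadRes (int l) (4 * \<delta> + 1)" and nonneg: "0 \<le> int l * int n + \<delta>"
  define N where "N = nat (int l * int n + \<delta>)"
  define c where "c = fps_nth (crank_series l m) N"
  \<comment> \<open>Modulo \<open>l\<close> the index \<open>N\<close> is \<delta>, and a solution
    \<open>t\<close> would make 4 \<delta> + 1 the square of 2 t + 1. \<open>QuadRes\<close> counts
    0 as a square, so the case of \<open>l\<close> dividing 2 t + 1 is excluded too.\<close>
  have "\<not> [int N = t * (t + 1)] (mod int l)" for t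
  proof
    assume "[int N = t * (t + 1)] (mod int l)"
    moreover have "[\<delta> = int N] (mod int l)"
      using nonneg by (simp add: N_def cong_def)
    ultimately have "[\<delta> = t * (t + 1)] (mod int l)"
      by (rule cong_trans[rotated])
    then have "[4 * \<delta> + 1 = 4 * (t * (t + 1)) + 1] (mod int l)"
      by (intro cong_add cong_mult cong_refl)
    also have "4 * (t * (t + 1)) + 1 = (2 * t + 1)\<^sup>2"
      by (simp add: power2_eq_square algebra_simps)
    finally show False
      using \<delta> cong_sym unfolding QuadRes_def by blast
  qed
  then have root: "laurent_eval c w = 0" if "w ^ l = 1" "w \<noteq> 1" for w
    unfolding c_def using assms(1,2) that by (intro crank_series_eval_unity_root)
  have dvd: "laurent_of_poly (cyclotomic_poly l) dvd c"
    using assms(1) root by (rule cyclotomic_poly_dvd_laurent)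
  have "exp (2 * pi * \<i> / l) \<noteq> 1"
    using complex_root_unity_eq_1[of l 1] l3 by (auto simp: mult_ac)
  moreover have "exp (2 * pi * \<i> / l) ^ l = 1"
    using complex_root_unity[of l 1] l3 by (simp add: mult_ac)
  ultimately have "laurent_eval c (exp (2 * pi * \<i> / l)) = 0"
    by (intro root)
  moreover have "[num_colored_partitions k 3 N = 0] (mod l)"
    using dvd_of_cyclotomic_dvd_laurent[OF assms(1) dvd, of "num_colored_partitions k 3 N"]
    by (simp add: c_def eval_1 cong_0_iff)
  ultimately show "let N = nat (int l * int n + \<delta>); c = fps_nth (crank_series l m) N
              in laurent_of_poly (cyclotomic_poly l) dvd c
                 \<and> laurent_eval c (exp (2 * pi * \<i> / l)) = 0
                 \<and> [num_colored_partitions k 3 N = 0] (mod l)"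
    using dvd by (simp add: Let_def N_def [symmetric] c_def [symmetric])
qed

end
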